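(* Let $m\ge5$ and let $R$ be a commutative unital ring. A basis for $H^1(\mathrm{Conf}(|K_m|,2);R)$, identified with the kernel of the Morse coboundary $\delta\colon\mu^1(C_m)\to\mu^2(C_m)$, is given by (1) the duals of the critical 1-dimensional faces $\left[\begin{smallmatrix}m&m\\ b&d\end{smallmatrix}\right]$ with $b<d<m-1$ and $\left[\begin{smallmatrix}a&c\\ m&m\end{smallmatrix}\right]$ with $a<c<m-1$, and (2) the elements $\langle a,b\rangle$ (where $a<m>b\ne a$ and $(a,b)\ne(m-1,m-2)$) satisfying either $a=m-1$, or $b=m-1$, or $(a,b)=(m-2,m-3)$.
   Context: $\mathrm{Conf}(X,2)=\{(x,y)\in X^2:x\ne y\}$; $|K_m|$ is the complete graph on $V_m=\{1,\ldots,m\}$. The complex $C_m$ (with $|C_m|\simeq\mathrm{Conf}(|K_m|,2)$): vertices are columns $\begin{smallmatrix}a\\ b\end{smallmatrix}$ with $a,b\in V_m$, $a\ne b$; $k$-faces are arrays $\left[\begin{smallmatrix}a_0&\cdots&a_k\\ b_0&\cdots&b_k\end{smallmatrix}\right]$ with weakly increasing rows, $a_j\ne b_j$, consecutive columns distinct, and each row having at most two distinct entries. Faces are oriented by the displayed order of columns. Conditions making a displayed array a face are implicit. $W_m$ is the gradient field on $C_m$ with the following pairings (it is the one produced by the paper's algorithm): (a) $\left[\begin{smallmatrix}a&a\\ b&d\end{smallmatrix}\right]\nearrow\left[\begin{smallmatrix}a&a&m\\ b&d&d\end{smallmatrix}\right]$, $a<m>d$; (b) $\left[\begin{smallmatrix}a&a\\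 b&m\end{smallmatrix}\right]\nearrow\left[\begin{smallmatrix}a&a&m-1\\ b&m&m\end{smallmatrix}\right]$, $a<m-1$; (c) $\left[\begin{smallmatrix}a&c\\ b&b\end{smallmatrix}\right]\nearrow\left[\begin{smallmatrix}a&c&c\\ b&b&m\end{smallmatrix}\right]$, $b<m>c$; (d) $\left[\begin{smallmatrix}a&m\\ b&b\end{smallmatrix}\right]\nearrow\left[\begin{smallmatrix}a&m&m\\ b&b&m-1\end{smallmatrix}\right]$, $b<m-1$; (e) $\left[\begin{smallmatrix}a&c\\ b&d\end{smallmatrix}\right]\nearrow\left[\begin{smallmatrix}a&c&c\\ b&b&d\end{smallmatrix}\right]$, $a<c$, $b<d$, $b\ne c$ and either $c<m>d$ or $c=m>d+1$; (f) $\left[\begin{smallmatrix}a&c\\ b&d\end{smallmatrix}\right]\nearrow\left[\begin{smallmatrix}a&a&c\\ b&d&d\end{smallmatrix}\right]$, $a<c$, $b<d$, $a\ne d$ and either $b=c<m>d$ or $c+1<m=d$; (g) $\left[\begin{smallmatrix}a\\ b\end{smallmatrix}\right]\nearrow\left[\begin{smallmatrix}a&m\\ b&m-1\end{smallmatrix}\right]$, either $b<m-1$ or $a<m-1=b$; (h) $\left[\begin{smallmatrix}a\\ m\end{smallmatrix}\right]\nearrow\left[\begin{smallmatrix}a&m-1\\ m&m\end{smallmatrix}\right]$, $a<m-1$; (i) $\left[\begin{smallmatrix}m-1\\ m\end{smallmatrix}\right]\nearrow\left[\begin{smallmatrix}m-1&m-1\\ m-2&m\end{smallmatrix}\right]$.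 The critical (unpaired) faces are: the vertex $\left[\begin{smallmatrix}m\\ m-1\end{smallmatrix}\right]$; the 1-faces (k.1) $\left[\begin{smallmatrix}a&m-1\\ b&m\end{smallmatrix}\right]$ with $a=m-1>b+1$ or $a<m-1\ge b$, (k.2) $\left[\begin{smallmatrix}m&m\\ b&d\end{smallmatrix}\right]$ with $d<m-1$, (k.3) $\left[\begin{smallmatrix}a&c\\ m&m\end{smallmatrix}\right]$ with $c<m-1$; the 2-faces $\left[\begin{smallmatrix}a&a&c\\ b&d&d\end{smallmatrix}\right]$ with $b\ne c<m>d$. Morse cochain complex: $\mu^p(C_m)$ is the free $R$-module on (duals of) critical $p$-faces. For a codimension-one face $\alpha\subset\beta$ let $\iota_{\alpha,\beta}=\pm1$ be the coefficient of $\alpha$ in $\partial\beta$, where $\partial[v_0,\ldots,v_i]=\sum_j(-1)^j[v_0,\ldots,\widehat{v_j},\ldots,v_i]$. Then $\delta(\alpha)=\sum_\beta\left(\sum_{\lambda}\mu(\lambda)\right)\beta$, where $\beta$ runs over critical $(p+1)$-faces and $\lambda$ over mixed paths $\beta\searrow\alpha_0\nearrow\beta_1\searrow\alpha_1\nearrow\cdots\nearrow\beta_k\searrow\alpha_k=\alpha$ ($k\ge0$; each $\alpha_{j-1}\nearrow\beta_j$ in $W_m$, each $\searrow$ passes to a codimension-one face by an inclusion not in $W_m$), with $\mu(\lambda)=\iota_{\alpha_0,\beta}\prod_{j=1}^k(-\iota_{\alpha_{j-1},\beta_j}\iota_{\alpha_j,\beta_j})$. The cohomology of $(\mu^*(C_m),\delta)$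 is canonically $H^*(\mathrm{Conf}(|K_m|,2);R)$, and $\delta\colon\mu^0\to\mu^1$ is zero. Elements $\langle a,b\rangle$: for $a<m>b\ne a$, $(a,b)\ne(m-1,m-2)$, $a,b\geq 1$, let $\{a,b\}$ (an ordered symbol) be the dual of $\left[\begin{smallmatrix}a&m-1\\ b&m\end{smallmatrix}\right]$. All sums are over positive integers. ($R_1$) For $1\le a\le2$, or $1\le a\le m-3$ with $b=m-1$, or $(a,b)=(3,1)$: $\langle a,b\rangle=\sum_{a\ne j\le b}\{a,j\}$. ($R_2$) For $4\le a\le m-1$ with $b=1$, or $a=m-1$ with $1\le b\le m-4$: $\langle a,b\rangle=\sum_{b\ne i\le a}\{i,b\}$. ($R_3$) $\langle3,2\rangle=\{3,2\}+\{3,1\}+\{2,3\}+\{2,1\}+\{1,3\}+\{1,2\}$. ($R_4$) For $4\le a\le m-2$: $\langle a,2\rangle=\sum_{2\ne i\le a}\{i,2\}+\sum_{i\le a-1}\{i,a\}$. ($R_5$) For $a,b\in\{3,\ldots,m-2\}$: $\langle a,b\rangle=\sum_{j\ne i\le a\ne j\le b}\{i,j\}+\sum_{i\le a-1}\{i,a\}$ (first sum over pairs $i,j$). ($R_6$) $\langle m-1,m-3\rangle=\{m-1,m-3\}-\sum\{i,j\}$, over $i,j$ with $m-3\ne j\ne i\le m-2\ge j$. ($R_7$) $\langle m-2,m-1\rangle=\{m-2,m-1\}-\sum\{i,j\}$, over $i,j$ with $m-2\ge j\ne i\le m-3$. *)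

theory Defs
  imports Complex_Main "HOL-Library.Function_Algebras"
begin

section \<open>The complex \<open>C\<^sub>m\<close>\<close>

text \<open>An array is the list of its columns; the column with upper entry \<open>a\<close> and lower entry \<open>b\<close>
  is the pair \<open>(a, b)\<close>. The order of the list is the orientation.\<close>

type_synonym face = "(nat \<times> nat) list"

definition faces :: "nat \<Rightarrow> nat \<Rightarrow> face set" where
  "faces m k = {\<sigma>. length \<sigma> = Suc k
     \<and> (\<forall>(a, b) \<in> set \<sigma>. a \<in> {1..m} \<and> b \<in> {1..m} \<and> a \<noteq> b)
     \<and> sorted (map fst \<sigma>) \<and> sorted (map snd \<sigma>)
     \<and> (\<forall>j. Suc j < length \<sigma> \<longrightarrow> \<sigma> ! j \<noteq> \<sigma> ! Suc j)
     \<and> card (set (map fst \<sigma>)) \<le> 2 \<and> card (set (map snd \<sigma>)) \<le> 2}"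

definition all_faces :: "nat \<Rightarrow> face set" where
  "all_faces m = (\<Union>k. faces m k)"

definition del_col :: "nat \<Rightarrow> face \<Rightarrow> face" where
  "del_col j \<sigma> = take j \<sigma> @ drop (Suc j) \<sigma>"

definition facet :: "nat \<Rightarrow> face \<Rightarrow> face \<Rightarrow> bool" where
  "facet m \<alpha> \<beta> \<longleftrightarrow> \<alpha> \<in> all_faces m \<and> \<beta> \<in> all_faces m \<and> (\<exists>j<length \<beta>. \<alpha> = del_col j \<beta>)"

text \<open>The coefficient of \<open>\<alpha>\<close> in \<open>\<partial>\<beta>\<close>; at most one summand is nonzero when \<open>\<beta>\<close> is a face,
  because the columns of a face are pairwise distinct.\<close>

definition incidence :: "face \<Rightarrow> face \<Rightarrow> int" where
  "incidence \<alpha> \<beta> = (\<Sum>j<length \<beta>. if \<alpha> = del_col j \<beta> then (- 1) ^ j else 0)"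

section \<open>The gradient field \<open>W\<^sub>m\<close>\<close>

inductive W_pairing :: "nat \<Rightarrow> face \<Rightarrow> face \<Rightarrow> bool" for m :: nat where
  a: "a < m \<Longrightarrow> d < m \<Longrightarrow>
      W_pairing m [(a, b), (a, d)] [(a, b), (a, d), (m, d)]"
| b: "a < m - 1 \<Longrightarrow>
      W_pairing m [(a, b), (a, m)] [(a, b), (a, m), (m - 1, m)]"
| c: "b < m \<Longrightarrow> c < m \<Longrightarrow>
      W_pairing m [(a, b), (c, b)] [(a, b), (c, b), (c, m)]"
| d: "b < m - 1 \<Longrightarrow>
      W_pairing m [(a, b), (m, b)] [(a, b), (m, b), (m, m - 1)]"
| e: "a < c \<Longrightarrow> b < d \<Longrightarrow> b \<noteq> c \<Longrightarrow> (c < m \<and> d < m) \<or> (c = m \<and> d + 1 < m) \<Longrightarrow>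
      W_pairing m [(a, b), (c, d)] [(a, b), (c, b), (c, d)]"
| f: "a < c \<Longrightarrow> b < d \<Longrightarrow> a \<noteq> d \<Longrightarrow> (b = c \<and> c < m \<and> d < m) \<or> (c + 1 < m \<and> d = m) \<Longrightarrow>
      W_pairing m [(a, b), (c, d)] [(a, b), (a, d), (c, d)]"
| g: "b < m - 1 \<or> (a < m - 1 \<and> b = m - 1) \<Longrightarrow>
      W_pairing m [(a, b)] [(a, b), (m, m - 1)]"
| h: "a < m - 1 \<Longrightarrow>
      W_pairing m [(a, m)] [(a, m), (m - 1, m)]"
| i: "W_pairing m [(m - 1, m)] [(m - 1, m - 2), (m - 1, m)]"

text \<open>The conditions making the displayed arrays faces are imposed here.\<close>

definition W :: "nat \<Rightarrow> (face \<times> face) set" where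
  "W m = {(\<alpha>, \<beta>). \<alpha> \<in> all_faces m \<and> \<beta> \<in> all_faces m \<and> W_pairing m \<alpha> \<beta>}"

definition critical :: "nat \<Rightarrow> nat \<Rightarrow> face set" where
  "critical m p = {\<sigma> \<in> faces m p. \<forall>\<tau>. (\<sigma>, \<tau>) \<notin> W m \<and> (\<tau>, \<sigma>) \<notin> W m}"

section \<open>The Morse cochain complex\<close>

text \<open>The mixed path
  \<open>\<beta> = \<beta>\<^sub>0 \<searrow> \<alpha>\<^sub>0 \<nearrow> \<beta>\<^sub>1 \<searrow> \<alpha>\<^sub>1 \<nearrow> \<dots> \<nearrow> \<beta>\<^sub>k \<searrow> \<alpha>\<^sub>k = \<alpha>\<close> is encoded as the nonempty list
  \<open>[(\<beta>\<^sub>0, \<alpha>\<^sub>0), \<dots>, (\<beta>\<^sub>k, \<alpha>\<^sub>k)]\<close> of its downward steps.\<close>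

definition mixed_paths :: "nat \<Rightarrow> face \<Rightarrow> face \<Rightarrow> (face \<times> face) list set" where
  "mixed_paths m \<beta> \<alpha> = {ps. ps \<noteq> [] \<and> fst (hd ps) = \<beta> \<and> snd (last ps) = \<alpha>
     \<and> (\<forall>(\<tau>, \<sigma>) \<in> set ps. facet m \<sigma> \<tau> \<and> (\<sigma>, \<tau>) \<notin> W m)
     \<and> (\<forall>j. Suc j < length ps \<longrightarrow> (snd (ps ! j), fst (ps ! Suc j)) \<in> W m)}"

definition path_weight :: "(face \<times> face) list \<Rightarrow> int" where
  "path_weight ps = incidence (snd (ps ! 0)) (fst (ps ! 0))
     * (\<Prod>j = 1..<length ps. - (incidence (snd (ps ! (j - 1))) (fst (ps ! j))
                              * incidence (snd (ps ! j)) (fst (ps ! j))))"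

text \<open>The free module on the duals of the critical \<open>p\<close>-faces consists of the functions supported
  on these (finitely many) faces, with pointwise operations.\<close>

definition scale_fun :: "'r::comm_ring_1 \<Rightarrow> ('a \<Rightarrow> 'r) \<Rightarrow> 'a \<Rightarrow> 'r" where
  "scale_fun r f = (\<lambda>x. r * f x)"

global_interpretation fun_module: module "scale_fun :: 'r::comm_ring_1 \<Rightarrow> ('a \<Rightarrow> 'r) \<Rightarrow> 'a \<Rightarrow> 'r"
  by standard (auto simp: scale_fun_def fun_eq_iff algebra_simps)

definition morse_cochains :: "nat \<Rightarrow> nat \<Rightarrow> (face \<Rightarrow> 'r::comm_ring_1) set" where
  "morse_cochains m p = {f. \<forall>\<sigma>. \<sigma> \<notin> critical m p \<longrightarrow> f \<sigma> = 0}"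

definition dual :: "face \<Rightarrow> face \<Rightarrow> 'r::comm_ring_1" where
  "dual \<alpha> = (\<lambda>\<sigma>. if \<sigma> = \<alpha> then 1 else 0)"

text \<open>The linear extension of \<open>\<delta>(\<alpha>) = (\<Sum>\<beta>. (\<Sum>\<lambda>. \<mu>(\<lambda>)) \<beta>)\<close>. As \<open>W\<^sub>m\<close> is acyclic, the sets of mixed
  paths are finite.\<close>

definition morse_coboundary ::
    "nat \<Rightarrow> nat \<Rightarrow> (face \<Rightarrow> 'r::comm_ring_1) \<Rightarrow> face \<Rightarrow> 'r" where
  "morse_coboundary m p f =
     (\<Sum>\<alpha> \<in> critical m p. scale_fun (f \<alpha>)
        (\<Sum>\<beta> \<in> critical m (Suc p).
           scale_fun (of_int (\<Sum>ps \<in> mixed_paths m \<beta> \<alpha>. path_weight ps)) (dual \<beta>)))"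

definition morse_cocycles :: "nat \<Rightarrow> nat \<Rightarrow> (face \<Rightarrow> 'r::comm_ring_1) set" where
  "morse_cocycles m p = {f \<in> morse_cochains m p. morse_coboundary m p f = 0}"

definition basis_family ::
    "'i set \<Rightarrow> ('i \<Rightarrow> 'a \<Rightarrow> 'r::comm_ring_1) \<Rightarrow> ('a \<Rightarrow> 'r) set \<Rightarrow> bool" where
  "basis_family I v M \<longleftrightarrow>
     inj_on v I \<and> fun_module.independent (v ` I) \<and> fun_module.span (v ` I) = M"

section \<open>The elements \<open>\<langle>a, b\<rangle>\<close>\<close>

definition symb_pairs :: "nat \<Rightarrow> (nat \<times> nat) set" where
  "symb_pairs m = {(a, b). 1 \<le> a \<and> a < m \<and> 1 \<le> b \<and> b < m \<and> b \<noteq> a \<and> (a, b) \<noteq> (m - 1, m - 2)}"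

definition symb :: "nat \<Rightarrow> nat \<Rightarrow> nat \<Rightarrow> face \<Rightarrow> 'r::comm_ring_1" where
  "symb m a b = dual [(a, b), (m - 1, m)]"

text \<open>For \<open>m \<ge> 5\<close> the seven cases are mutually exclusive and cover \<open>symb_pairs m\<close>; the value
  outside of \<open>symb_pairs m\<close> is irrelevant.\<close>

definition angle :: "nat \<Rightarrow> nat \<Rightarrow> nat \<Rightarrow> face \<Rightarrow> 'r::comm_ring_1" where
  "angle m a b =
    (if (1 \<le> a \<and> a \<le> 2) \<or> (1 \<le> a \<and> a \<le> m - 3 \<and> b = m - 1) \<or> (a, b) = (3, 1) then
       (\<Sum>j \<in> {1..b} - {a}. symb m a j)
     else if (4 \<le> a \<and> a \<le> m - 1 \<and> b = 1) \<or> (a = m - 1 \<and> 1 \<le> b \<and> b \<le> m - 4) then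
       (\<Sum>i \<in> {1..a} - {b}. symb m i b)
     else if (a, b) = (3, 2) then
       symb m 3 2 + symb m 3 1 + symb m 2 3 + symb m 2 1 + symb m 1 3 + symb m 1 2
     else if 4 \<le> a \<and> a \<le> m - 2 \<and> b = 2 then
       (\<Sum>i \<in> {1..a} - {2}. symb m i 2) + (\<Sum>i = 1..a - 1. symb m i a)
     else if a \<in> {3..m - 2} \<and> b \<in> {3..m - 2} then
       (\<Sum>(i, j) \<in> {(i, j). i \<in> {1..a} \<and> j \<in> {1..b} \<and> j \<noteq> i \<and> j \<noteq> a}. symb m i j)
       + (\<Sum>i = 1..a - 1. symb m i a)
     else if (a, b) = (m - 1, m - 3) then
       symb m (m - 1) (m - 3)
       - (\<Sum>(i, j) \<in> {(i, j). i \<in> {1..m - 2} \<and> j \<in> {1..m - 2} \<and> j \<noteq> m - 3 \<and> j \<noteq> i}. symb m i j)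
     else if (a, b) = (m - 2, m - 1) then
       symb m (m - 2) (m - 1)
       - (\<Sum>(i, j) \<in> {(i, j). i \<in> {1..m - 3} \<and> j \<in> {1..m - 2} \<and> j \<noteq> i}. symb m i j)
     else 0)"

definition basis_faces :: "nat \<Rightarrow> face set" where
  "basis_faces m = {[(m, b), (m, d)] | b d. 1 \<le> b \<and> b < d \<and> d < m - 1}
                 \<union> {[(a, m), (c, m)] | a c. 1 \<le> a \<and> a < c \<and> c < m - 1}"

definition basis_pairs :: "nat \<Rightarrow> (nat \<times> nat) set" where
  "basis_pairs m = {(a, b) \<in> symb_pairs m. a = m - 1 \<or> b = m - 1 \<or> (a, b) = (m - 2, m - 3)}"

end

theory Submission
  imports Defs
begin

text \<open>
A Morse cochain \<open>f\<close> of degree \<open>1\<close> extends to a simplicial cochain \<open>F\<close> on \<open>C\<^sub>m\<close> that vanishes on the edges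
paired with a vertex and satisfies \<open>F(\<partial>\<tau>) = 0\<close> for every triangle \<open>\<tau>\<close> paired with an edge. Moving an
edge across the triangle it is paired with does not change the value of \<open>F\<close>, so the sum over mixed
paths starting in a critical triangle \<open>\<beta>\<close> is \<open>F(\<partial>\<beta>)\<close> (\<open>morse_flow\<close>). The Morse coboundary of \<open>f\<close> thus
vanishes iff \<open>F\<close> is a simplicial cocycle, and no mixed path has to be enumerated.

The extension has a closed form (\<open>extend_cochain\<close>). Let \<open>s(i, j)\<close> be the coefficient of \<open>f\<close> at the
symbol \<open>{i, j}\<close>, with \<open>s(m - 1, m - 2) = 0\<close>. Evaluating \<open>F\<close> on the boundaries of the critical triangles
turns the cocycle condition into \<open>s(a, b) + s(c, d) = s(a, d) + s(c, b)\<close> for disjoint pairs \<open>a < c\<close> and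
\<open>b < d\<close> of numbers below \<open>m\<close> (\<open>morse_cocycle_iff\<close>). The coefficients at the remaining critical edges are
unconstrained; their duals are the first part of the basis.

For the second part, each \<open>\<langle>a, b\<rangle>\<close> of the family satisfies \<open>s(i, j) = x i + y j\<close>, which makes it a cocycle,
and its coefficient is \<open>1\<close> at the symbol \<open>{a, b}\<close> and \<open>0\<close> at the symbols of all other members
(\<open>angle_basis_pair\<close>). Conversely a cocycle with coefficient \<open>0\<close> at all these symbols and at the faces of
the first part is zero (\<open>cocycle_zero_if_zero_on_basis_points\<close>). The family is therefore dual to a
separating set of coordinates of the module of cocycles, which makes it a basis over every
coefficient ring (\<open>basis_family_dual_points\<close>).
\<close>

section \<open>Faces of dimension at most two\<close>

lemma vertex_iff: "[(a, b)] \<in> all_faces m \<longleftrightarrow> a \<in> {1..m} \<and> b \<in> {1..m} \<and> a \<noteq> b"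
  by (auto simp: all_faces_def faces_def)

lemma edge_iff:
  "[(a, b), (c, d)] \<in> all_faces m \<longleftrightarrow>
     1 \<le> a \<and> c \<le> m \<and> 1 \<le> b \<and> d \<le> m \<and> a \<noteq> b \<and> c \<noteq> d \<and> a \<le> c \<and> b \<le> d \<and> (a < c \<or> b < d)"
  by (auto simp: all_faces_def faces_def less_Suc_eq card_insert_if)

text \<open>Of the ways in which two weakly increasing rows with at most two distinct entries each can have
three columns, only two leave consecutive columns distinct: the upper row jumps after the lower
one, or before it.\<close>

lemma triangle_iff:
  "[(a, b), (c, d), (e, f)] \<in> all_faces m \<longleftrightarrow>
     1 \<le> a \<and> e \<le> m \<and> 1 \<le> b \<and> f \<le> m \<and> a \<noteq> b \<and> c \<noteq> d \<and> e \<noteq> f \<and> a < e \<and> b < f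
     \<and> (a = c \<and> d = f \<or> c = e \<and> b = d)"
  by (auto simp: all_faces_def faces_def less_Suc_eq card_insert_if split: if_splits)

lemma faces_Suc_length: "\<sigma> \<in> faces m k \<longleftrightarrow> \<sigma> \<in> all_faces m \<and> length \<sigma> = Suc k"
  by (auto simp: all_faces_def faces_def)

lemma length_2E:
  assumes "length \<sigma> = 2"
  obtains a b c d where "\<sigma> = [(a, b), (c, d)]"
  using assms by (auto simp: numeral_2_eq_2 length_Suc_conv)

lemma length_3E:
  assumes "length \<tau> = 3"
  obtains a b c d e f where "\<tau> = [(a, b), (c, d), (e, f)]"
  using assms by (auto simp: numeral_3_eq_3 length_Suc_conv)

lemma finite_faces: "finite (faces m k)"
proof (rule finite_subset)
  show "faces m k \<subseteq> {xs. set xs \<subseteq> {1..m} \<times> {1..m} \<and> length xs = Suc k}"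
    by (auto simp: faces_def)
  show "finite {xs. set xs \<subseteq> {1..m::nat} \<times> {1..m::nat} \<and> length xs = Suc k}"
    by (intro finite_lists_length_eq) auto
qed

lemma finite_critical: "finite (critical m p)"
  by (rule finite_subset[OF _ finite_faces[of m p]]) (auto simp: critical_def)

lemma facet_triangle_iff:
  assumes "[x, y, z] \<in> all_faces m"
  shows "facet m \<sigma> [x, y, z] \<longleftrightarrow> \<sigma> \<in> {[y, z], [x, z], [x, y]}"
proof -
  have "[y, z] \<in> all_faces m \<and> [x, z] \<in> all_faces m \<and> [x, y] \<in> all_faces m"
  proof -
    obtain a b c d e f where "x = (a, b)" "y = (c, d)" "z = (e, f)"
      by (metis surj_pair)
    then show ?thesis using assms
      by (simp only: edge_iff triangle_iff) (elim conjE disjE, simp_all)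
  qed
  moreover have "(\<exists>j<length [x, y, z]. \<sigma> = del_col j [x, y, z]) \<longleftrightarrow> \<sigma> \<in> {[y, z], [x, z], [x, y]}"
  proof -
    have "{..<length [x, y, z]} = {0, 1, 2}" by auto
    moreover have "del_col 0 [x, y, z] = [y, z]" "del_col 1 [x, y, z] = [x, z]"
      "del_col 2 [x, y, z] = [x, y]"
      by (simp_all add: del_col_def)
    ultimately show ?thesis unfolding Bex_def[symmetric] lessThan_iff[symmetric] by auto
  qed
  ultimately show ?thesis using assms unfolding facet_def
    by (metis empty_iff insert_iff)
qed

lemma triangle_distinct:
  assumes "[x, y, z] \<in> all_faces m"
  shows "distinct [x, y, z]"
  using assms by (cases x; cases y; cases z) (auto simp: triangle_iff)

lemma incidence_triangle:
  assumes "distinct [x, y, z]"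
  shows "incidence [y, z] [x, y, z] = 1" "incidence [x, z] [x, y, z] = -1"
    "incidence [x, y] [x, y, z] = 1"
  using assms by (auto simp: incidence_def del_col_def lessThan_Suc numeral_3_eq_3)

lemma facet_length: "facet m \<sigma> \<tau> \<Longrightarrow> length \<tau> = Suc (length \<sigma>)"
  by (auto simp: facet_def del_col_def)

lemma finite_facets: "finite {\<sigma>. facet m \<sigma> \<tau> \<and> P \<sigma>}"
  by (rule finite_subset[where B = "(\<lambda>j. del_col j \<tau>) ` {..<length \<tau>}"]) (auto simp: facet_def)

section \<open>The gradient field on edges and triangles\<close>

lemma W_length: "(\<sigma>, \<tau>) \<in> W m \<Longrightarrow> length \<tau> = Suc (length \<sigma>)"
  by (auto simp: W_def elim!: W_pairing.cases)

text \<open>The cases (a) to (f) of the gradient field, in this order. Once they are a disjunction over the two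
columns of the edge, uniqueness of partners and criticality become arithmetic.\<close>

lemma W_edge_iff:
  "([(a, b), (c, d)], \<tau>) \<in> W m \<longleftrightarrow> [(a, b), (c, d)] \<in> all_faces m \<and>
    (a = c \<and> a < m \<and> d < m \<and> \<tau> = [(a, b), (a, d), (m, d)] \<or>
     a = c \<and> a < m - 1 \<and> d = m \<and> \<tau> = [(a, b), (a, m), (m - 1, m)] \<or>
     b = d \<and> b < m \<and> c < m \<and> \<tau> = [(a, b), (c, b), (c, m)] \<or>
     b = d \<and> b < m - 1 \<and> c = m \<and> \<tau> = [(a, b), (m, b), (m, m - 1)] \<or>
     a < c \<and> b < d \<and> b \<noteq> c \<and> (c < m \<and> d < m \<or> c = m \<and> d + 1 < m)
       \<and> \<tau> = [(a, b), (c, b), (c, d)] \<or>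
     a < c \<and> b < d \<and> a \<noteq> d \<and> (b = c \<and> c < m \<and> d < m \<or> c + 1 < m \<and> d = m)
       \<and> \<tau> = [(a, b), (a, d), (c, d)])"
  (is "?L \<longleftrightarrow> ?R")
proof
  assume ?L
  then have "[(a, b), (c, d)] \<in> all_faces m" and pairing: "W_pairing m [(a, b), (c, d)] \<tau>"
    by (simp_all add: W_def)
  moreover from pairing have "a = c \<and> a < m \<and> d < m \<and> \<tau> = [(a, b), (a, d), (m, d)] \<or>
     a = c \<and> a < m - 1 \<and> d = m \<and> \<tau> = [(a, b), (a, m), (m - 1, m)] \<or>
     b = d \<and> b < m \<and> c < m \<and> \<tau> = [(a, b), (c, b), (c, m)] \<or>
     b = d \<and> b < m - 1 \<and> c = m \<and> \<tau> = [(a, b), (m, b), (m, m - 1)] \<or>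
     a < c \<and> b < d \<and> b \<noteq> c \<and> (c < m \<and> d < m \<or> c = m \<and> d + 1 < m)
       \<and> \<tau> = [(a, b), (c, b), (c, d)] \<or>
     a < c \<and> b < d \<and> a \<noteq> d \<and> (b = c \<and> c < m \<and> d < m \<or> c + 1 < m \<and> d = m)
       \<and> \<tau> = [(a, b), (a, d), (c, d)]"
    by cases blast+
  ultimately show ?R by blast
next
  assume R: ?R
  then have "W_pairing m [(a, b), (c, d)] \<tau>"
    by (elim conjE disjE; simp only:; blast intro: W_pairing.intros)
  moreover from R have "\<tau> \<in> all_faces m"
    by (elim conjE disjE; simp add: edge_iff triangle_iff)
  ultimately show ?L using R by (simp add: W_def)
qed

text \<open>For an edge, the six alternatives exclude each other; together with \<open>W_down_unique\<close> this
is the part of the matching property that the sums over mixed paths rely on.\<close>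

lemma W_up_unique:
  assumes "(\<sigma>, \<tau>) \<in> W m" "(\<sigma>, \<tau>') \<in> W m" "length \<sigma> = 2"
  shows "\<tau> = \<tau>'"
proof -
  obtain a b c d where \<sigma>: "\<sigma> = [(a, b), (c, d)]" using assms(3) by (rule length_2E)
  show ?thesis using assms(1,2) unfolding \<sigma> W_edge_iff edge_iff
    apply (elim conjE disjE)
    apply (simp_all only:)
    done
qed

lemma W_facet:
  assumes "(\<sigma>, \<tau>) \<in> W m" "length \<tau> = 3"
  shows "facet m \<sigma> \<tau>"
proof -
  obtain a b c d where \<sigma>: "\<sigma> = [(a, b), (c, d)]"
    using W_length[OF assms(1)] assms(2) length_2E[of \<sigma>] by fastforce
  have \<tau>: "\<tau> \<in> all_faces m" using assms(1) by (simp add: W_def)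
  obtain x y z where xyz: "\<tau> = [x, y, z]"
    using assms(2) by (rule length_3E)
  have "\<sigma> = [x, y] \<or> \<sigma> = [x, z]"
    using assms(1) xyz unfolding \<sigma> W_edge_iff by (elim conjE disjE; simp)
  then show ?thesis
    unfolding xyz facet_triangle_iff[OF \<tau>[unfolded xyz]] by blast
qed

lemma W_vertex_iff:
  "([(a, b)], \<tau>) \<in> W m \<longleftrightarrow> [(a, b)] \<in> all_faces m \<and> \<tau> \<in> all_faces m \<and>
    ((b < m - 1 \<or> a < m - 1 \<and> b = m - 1) \<and> \<tau> = [(a, b), (m, m - 1)] \<or>
     a < m - 1 \<and> b = m \<and> \<tau> = [(a, b), (m - 1, m)] \<or>
     a = m - 1 \<and> b = m \<and> \<tau> = [(m - 1, m - 2), (m - 1, m)])"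
  (is "?L \<longleftrightarrow> ?R")
proof
  assume ?L
  then have faces: "[(a, b)] \<in> all_faces m" "\<tau> \<in> all_faces m" and "W_pairing m [(a, b)] \<tau>"
    by (simp_all add: W_def)
  from this(3) have "(b < m - 1 \<or> a < m - 1 \<and> b = m - 1) \<and> \<tau> = [(a, b), (m, m - 1)] \<or>
     a < m - 1 \<and> b = m \<and> \<tau> = [(a, b), (m - 1, m)] \<or>
     a = m - 1 \<and> b = m \<and> \<tau> = [(m - 1, m - 2), (m - 1, m)]"
    by cases blast+
  with faces show ?R by blast
next
  assume R: ?R
  then have "W_pairing m [(a, b)] \<tau>"
    by (elim conjE disjE; simp only:; blast intro: W_pairing.intros)
  with R show ?L by (simp add: W_def)
qed

lemma W_down_unique:
  assumes "(\<sigma>, \<tau>) \<in> W m" "(\<sigma>', \<tau>) \<in> W m" "length \<tau> = 3"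
  shows "\<sigma> = \<sigma>'"
proof -
  obtain a b c d where \<sigma>: "\<sigma> = [(a, b), (c, d)]"
    using W_length[OF assms(1)] assms(3) length_2E[of \<sigma>] by fastforce
  obtain a' b' c' d' where \<sigma>': "\<sigma>' = [(a', b'), (c', d')]"
    using W_length[OF assms(2)] assms(3) length_2E[of \<sigma>'] by fastforce
  show ?thesis using assms(1,2) unfolding \<sigma> \<sigma>' W_edge_iff
    apply (elim conjE disjE)
    apply (simp_all only: list.inject prod.inject simp_thms)
    apply simp_all
    done
qed

lemma W_edge_bounds:
  assumes "([(a, b), (c, d)], \<tau>) \<in> W m"
  shows "a \<le> c \<and> b \<le> d \<and> (c < m \<and> d < m \<or> c = m \<and> a < m \<and> d < m - 1 \<or> d = m \<and> b < m \<and> c < m - 1)"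
proof -
  have "a \<le> c \<and> b \<le> d \<and> d \<le> m \<and> c \<le> m \<and> (a < c \<or> b < d)"
    using assms unfolding W_edge_iff edge_iff by blast
  moreover have "c < m \<and> d < m \<or> a = c \<and> c < m - 1 \<and> d = m \<or> b = d \<and> d < m - 1 \<and> c = m \<or>
    a < c \<and> c = m \<and> d + 1 < m \<or> b < d \<and> d = m \<and> c + 1 < m"
    using assms unfolding W_edge_iff by blast
  ultimately show ?thesis by linarith
qed

text \<open>Witness of acyclicity. Call an edge diagonal if both entries change along it. Across matched
triangles the flow leads from diagonal edges without entry \<open>m\<close> to non-diagonal ones without it, then
to diagonal and finally to non-diagonal edges that end in a vertex with an entry \<open>m\<close>.\<close>

definition flow_rank :: "nat \<Rightarrow> face \<Rightarrow> nat" where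
  "flow_rank m \<sigma> = (case \<sigma> of [(a, b), (c, d)] \<Rightarrow>
     (if c < m \<and> d < m then 2 else 0) + (if a < c \<and> b < d then 1 else 0) | _ \<Rightarrow> 0)"

lemma flow_rank_descends:
  assumes "(\<sigma>, \<tau>) \<in> W m" "length \<tau> = 3" "facet m \<sigma>' \<tau>" "\<sigma>' \<noteq> \<sigma>" "(\<sigma>', \<tau>') \<in> W m"
  shows "flow_rank m \<sigma>' < flow_rank m \<sigma>"
proof -
  obtain a b c d where \<sigma>: "\<sigma> = [(a, b), (c, d)]"
    using W_length[OF assms(1)] assms(2) length_2E[of \<sigma>] by fastforce
  obtain a' b' c' d' where \<sigma>': "\<sigma>' = [(a', b'), (c', d')]"
    using facet_length[OF assms(3)] assms(2) length_2E[of \<sigma>'] by fastforce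
  have \<tau>: "\<tau> \<in> all_faces m" using assms(1) by (simp add: W_def)
  have src: "c' < m \<and> d' < m \<or> c' = m \<and> a' < m \<and> d' < m - 1 \<or> d' = m \<and> b' < m \<and> c' < m - 1"
    using W_edge_bounds[OF assms(5)[unfolded \<sigma>']] by blast
  have fc: "\<sigma>' \<in> {[y, z], [x, z], [x, y]}" if "\<tau> = [x, y, z]" for x y z
    using assms(3) facet_triangle_iff[OF \<tau>[unfolded that]] that by blast
  have edge: "a < c \<or> b < d"
    using assms(1) unfolding \<sigma> W_edge_iff edge_iff by blast
  from assms(1)[unfolded \<sigma> W_edge_iff, THEN conjunct2] show ?thesis
  proof (elim disjE, goal_cases)
    case 1
    then show ?case
      using fc[OF 1[THEN conjunct2, THEN conjunct2, THEN conjunct2]] src assms(4) edge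
      unfolding \<sigma> \<sigma>' flow_rank_def by (elim insertE emptyE) auto
  next
    case 2
    then show ?case
      using fc[OF 2[THEN conjunct2, THEN conjunct2, THEN conjunct2]] src assms(4) edge
      unfolding \<sigma> \<sigma>' flow_rank_def by (elim insertE emptyE) auto
  next
    case 3
    then show ?case
      using fc[OF 3[THEN conjunct2, THEN conjunct2, THEN conjunct2]] src assms(4) edge
      unfolding \<sigma> \<sigma>' flow_rank_def by (elim insertE emptyE) auto
  next
    case 4
    then show ?case
      using fc[OF 4[THEN conjunct2, THEN conjunct2, THEN conjunct2]] src assms(4) edge
      unfolding \<sigma> \<sigma>' flow_rank_def by (elim insertE emptyE) auto
  next
    case 5
    then show ?case
      using fc[OF 5[THEN conjunct2, THEN conjunct2, THEN conjunct2, THEN conjunct2]] src assms(4) edge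
      unfolding \<sigma> \<sigma>' flow_rank_def by (elim insertE emptyE) auto
  next
    case 6
    then show ?case
      using fc[OF 6[THEN conjunct2, THEN conjunct2, THEN conjunct2, THEN conjunct2]] src assms(4) edge
      unfolding \<sigma> \<sigma>' flow_rank_def by (elim insertE emptyE) auto
  qed
qed

section \<open>Mixed paths compute the boundary of an extended cochain\<close>

lemma mixed_paths_Cons:
  "q # ps \<in> mixed_paths m \<beta> \<alpha> \<longleftrightarrow>
     fst q = \<beta> \<and> facet m (snd q) \<beta> \<and> (snd q, \<beta>) \<notin> W m \<and>
     (if ps = [] then snd q = \<alpha>
      else \<exists>\<tau>. (snd q, \<tau>) \<in> W m \<and> ps \<in> mixed_paths m \<tau> \<alpha>)"
proof -
  let ?L = "\<lambda>xs. \<forall>j. Suc j < length xs \<longrightarrow> (snd (xs ! j), fst (xs ! Suc j)) \<in> W m"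
  have "?L (q # ps) \<longleftrightarrow> ps = [] \<or> (snd q, fst (hd ps)) \<in> W m \<and> ?L ps"
  proof (cases ps)
    case (Cons r rs)
    have split: "(\<forall>j. P j) \<longleftrightarrow> P 0 \<and> (\<forall>j. P (Suc j))" for P :: "nat \<Rightarrow> bool"
      by (metis not0_implies_Suc)
    show ?thesis unfolding Cons by (subst split) simp
  qed simp
  then show ?thesis by (cases q; cases ps) (auto simp: mixed_paths_def)
qed

lemma Nil_notin_mixed_paths: "[] \<notin> mixed_paths m \<beta> \<alpha>"
  by (simp add: mixed_paths_def)

lemma path_weight_single: "path_weight [(\<tau>, \<sigma>)] = incidence \<sigma> \<tau>"
  by (simp add: path_weight_def)

lemma path_weight_Cons:
  assumes "ps \<in> mixed_paths m \<tau>' \<alpha>"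
  shows "path_weight ((\<tau>, \<sigma>) # ps) = - incidence \<sigma> \<tau> * incidence \<sigma> \<tau>' * path_weight ps"
proof -
  have ps: "ps \<noteq> []" "fst (ps ! 0) = \<tau>'"
    using assms by (auto simp: mixed_paths_def hd_conv_nth)
  let ?w = "\<lambda>xs j. - (incidence (snd (xs ! (j - 1))) (fst (xs ! j))
                        * incidence (snd (xs ! j)) (fst (xs ! j)))"
  have "(\<Prod>j = 1..<Suc (length ps). ?w ((\<tau>, \<sigma>) # ps) j)
      = (\<Prod>j = 0..<length ps. ?w ((\<tau>, \<sigma>) # ps) (Suc j))"
    by (simp only: One_nat_def prod.shift_bounds_Suc_ivl)
  also have "\<dots> = ?w ((\<tau>, \<sigma>) # ps) 1 * (\<Prod>j = 1..<length ps. ?w ((\<tau>, \<sigma>) # ps) (Suc j))"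
    using ps(1) by (simp add: prod.atLeast_Suc_lessThan)
  also have "(\<Prod>j = 1..<length ps. ?w ((\<tau>, \<sigma>) # ps) (Suc j)) = (\<Prod>j = 1..<length ps. ?w ps j)"
    by (rule prod.cong) (auto simp: nth_Cons')
  finally show ?thesis using ps(2) by (simp add: path_weight_def)
qed

text \<open>A mixed path either stops after its first downward step, or climbs from there along a pair of the
gradient field and continues as a mixed path. All path sums are computed through this recursion.\<close>

lemma mixed_paths_unfold:
  "mixed_paths m \<tau> \<alpha> =
     (if facet m \<alpha> \<tau> \<and> (\<alpha>, \<tau>) \<notin> W m then {[(\<tau>, \<alpha>)]} else {})
     \<union> (\<Union>\<sigma>\<in>{\<sigma>. facet m \<sigma> \<tau> \<and> (\<sigma>, \<tau>) \<notin> W m}. \<Union>\<tau>'\<in>{\<tau>'. (\<sigma>, \<tau>') \<in> W m}.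
          (#) (\<tau>, \<sigma>) ` mixed_paths m \<tau>' \<alpha>)" (is "?L = ?R")
proof (rule set_eqI)
  fix ps
  show "ps \<in> ?L \<longleftrightarrow> ps \<in> ?R"
  proof (cases ps)
    case Nil
    then show ?thesis by (auto simp: Nil_notin_mixed_paths)
  next
    case (Cons q qs)
    show ?thesis
      unfolding Cons mixed_paths_Cons
      by (cases q; cases "qs = []") (auto simp: Nil_notin_mixed_paths)
  qed
qed

text \<open>The value \<open>F(\<partial>\<tau>)\<close> of a simplicial cochain \<open>F\<close>.\<close>

definition boundary_value :: "nat \<Rightarrow> (face \<Rightarrow> 'r::comm_ring_1) \<Rightarrow> face \<Rightarrow> 'r" where
  "boundary_value m F \<tau> = (\<Sum>\<sigma> | facet m \<sigma> \<tau>. of_int (incidence \<sigma> \<tau>) * F \<sigma>)"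

lemma boundary_value_triangle:
  fixes F :: "face \<Rightarrow> 'r::comm_ring_1"
  assumes "[x, y, z] \<in> all_faces m"
  shows "boundary_value m F [x, y, z] = F [y, z] - F [x, z] + F [x, y]"
proof -
  note distinct = triangle_distinct[OF assms]
  note incidence = incidence_triangle[OF distinct]
  have "{\<sigma>. facet m \<sigma> [x, y, z]} = {[y, z], [x, z], [x, y]}"
    using facet_triangle_iff[OF assms] by blast
  moreover have "[y, z] \<noteq> [x, z]" "[y, z] \<noteq> [x, y]" "[x, z] \<noteq> [x, y]"
    using distinct by auto
  then have "(\<Sum>\<sigma>\<in>{[y, z], [x, z], [x, y]}. g \<sigma>) = g [y, z] + (g [x, z] + g [x, y])"
    for g :: "face \<Rightarrow> 'r"
    by (metis (no_types, lifting) empty_iff finite.emptyI finite_insert insertE sum.empty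
        sum.insert add.right_neutral)
  ultimately show ?thesis
    unfolding boundary_value_def by (simp only: incidence) simp
qed

lemma finite_W_above: "finite {\<tau>. (\<sigma>, \<tau>) \<in> W m}"
proof (rule finite_subset)
  show "{\<tau>. (\<sigma>, \<tau>) \<in> W m} \<subseteq> faces m (length \<sigma>)"
    using W_length by (auto simp: faces_Suc_length W_def)
qed (rule finite_faces)

definition path_sum :: "nat \<Rightarrow> face \<Rightarrow> face \<Rightarrow> int" where
  "path_sum m \<beta> \<alpha> = (\<Sum>ps \<in> mixed_paths m \<beta> \<alpha>. path_weight ps)"

text \<open>Finiteness is needed because the sum over an infinite set of paths would be \<open>0\<close> by convention and
would not satisfy the recursion.\<close>

lemma path_sum_unfold:
  assumes "\<And>\<sigma> \<tau>'. facet m \<sigma> \<tau> \<Longrightarrow> (\<sigma>, \<tau>) \<notin> W m \<Longrightarrow> (\<sigma>, \<tau>') \<in> W m \<Longrightarrow> finite (mixed_paths m \<tau>' \<alpha>)"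
  shows "path_sum m \<tau> \<alpha> = (\<Sum>\<sigma> | facet m \<sigma> \<tau> \<and> (\<sigma>, \<tau>) \<notin> W m. incidence \<sigma> \<tau> *
     ((if \<sigma> = \<alpha> then 1 else 0) - (\<Sum>\<tau>' | (\<sigma>, \<tau>') \<in> W m. incidence \<sigma> \<tau>' * path_sum m \<tau>' \<alpha>)))"
proof -
  let ?D = "{\<sigma>. facet m \<sigma> \<tau> \<and> (\<sigma>, \<tau>) \<notin> W m}"
  let ?A = "if \<alpha> \<in> ?D then {[(\<tau>, \<alpha>)]} else {}"
  let ?P = "\<lambda>\<sigma> \<tau>'. (#) (\<tau>, \<sigma>) ` mixed_paths m \<tau>' \<alpha>"
  let ?U = "\<lambda>\<sigma>. \<Union>\<tau>'\<in>{\<tau>'. (\<sigma>, \<tau>') \<in> W m}. ?P \<sigma> \<tau>'"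
  have fin: "finite (?P \<sigma> \<tau>')" if "\<sigma> \<in> ?D" "(\<sigma>, \<tau>') \<in> W m" for \<sigma> \<tau>'
    using assms that by blast
  have finU: "finite (?U \<sigma>)" if "\<sigma> \<in> ?D" for \<sigma>
    using fin[OF that] by (intro finite_UN_I finite_W_above) simp
  have head: "mixed_paths m \<tau>' \<alpha> \<inter> mixed_paths m \<tau>'' \<alpha> = {}" if "\<tau>' \<noteq> \<tau>''" for \<tau>' \<tau>''
    using that by (auto simp: mixed_paths_def)
  have sumP: "sum path_weight (?P \<sigma> \<tau>') = - incidence \<sigma> \<tau> * (incidence \<sigma> \<tau>' * path_sum m \<tau>' \<alpha>)" for \<sigma> \<tau>'
    by (simp add: sum.reindex path_weight_Cons path_sum_def sum_distrib_left mult.assoc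
        sum_negf)
  have sumU: "sum path_weight (?U \<sigma>) =
      - incidence \<sigma> \<tau> * (\<Sum>\<tau>' | (\<sigma>, \<tau>') \<in> W m. incidence \<sigma> \<tau>' * path_sum m \<tau>' \<alpha>)"
    if "\<sigma> \<in> ?D" for \<sigma>
  proof -
    have "sum path_weight (?U \<sigma>) = (\<Sum>\<tau>' | (\<sigma>, \<tau>') \<in> W m. sum path_weight (?P \<sigma> \<tau>'))"
    proof (rule sum.UNION_disjoint)
      show "\<forall>i\<in>{\<tau>'. (\<sigma>, \<tau>') \<in> W m}. \<forall>j\<in>{\<tau>'. (\<sigma>, \<tau>') \<in> W m}. i \<noteq> j \<longrightarrow> ?P \<sigma> i \<inter> ?P \<sigma> j = {}"
        using head by blast
    qed (use fin[OF that] finite_W_above in auto)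
    then show ?thesis unfolding sumP sum_distrib_left .
  qed
  have "path_sum m \<tau> \<alpha> = sum path_weight (?A \<union> (\<Union>\<sigma>\<in>?D. ?U \<sigma>))"
    unfolding path_sum_def by (subst mixed_paths_unfold) simp
  also have "\<dots> = sum path_weight ?A + sum path_weight (\<Union>\<sigma>\<in>?D. ?U \<sigma>)"
  proof (rule sum.union_disjoint)
    show "finite (\<Union>\<sigma>\<in>?D. ?U \<sigma>)"
      using finite_facets finU by (rule finite_UN_I)
    show "?A \<inter> (\<Union>\<sigma>\<in>?D. ?U \<sigma>) = {}"
      by (auto simp: Nil_notin_mixed_paths)
  qed simp
  also have "sum path_weight (\<Union>\<sigma>\<in>?D. ?U \<sigma>) = (\<Sum>\<sigma>\<in>?D. sum path_weight (?U \<sigma>))"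
    by (rule sum.UNION_disjoint) (use finU finite_facets in auto)
  also have "\<dots> = (\<Sum>\<sigma>\<in>?D. - incidence \<sigma> \<tau> * (\<Sum>\<tau>' | (\<sigma>, \<tau>') \<in> W m. incidence \<sigma> \<tau>' * path_sum m \<tau>' \<alpha>))"
    by (rule sum.cong[OF refl]) (rule sumU)
  also have "sum path_weight ?A = (\<Sum>\<sigma>\<in>?D. if \<sigma> = \<alpha> then incidence \<alpha> \<tau> else 0)"
    by (simp add: sum.delta' finite_facets path_weight_single)
  finally show ?thesis
    unfolding sum.distrib[symmetric]
    by (simp add: algebra_simps cong: sum.cong) (intro sum.cong refl, simp add: algebra_simps)
qed

lemma mixed_paths_finite:
  assumes "length \<tau> = 3"
    and "\<And>\<sigma> \<tau>'. facet m \<sigma> \<tau> \<Longrightarrow> (\<sigma>, \<tau>) \<notin> W m \<Longrightarrow> (\<sigma>, \<tau>') \<in> W m \<Longrightarrow> flow_rank m \<sigma> < n"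
  shows "finite (mixed_paths m \<tau> \<alpha>)"
  using assms
proof (induction n arbitrary: \<tau> rule: less_induct)
  case (less n)
  have "finite (mixed_paths m \<tau>' \<alpha>)"
    if \<sigma>: "facet m \<sigma> \<tau>" "(\<sigma>, \<tau>) \<notin> W m" "(\<sigma>, \<tau>') \<in> W m" for \<sigma> \<tau>'
  proof -
    have len: "length \<tau>' = 3"
      using facet_length[OF \<sigma>(1)] W_length[OF \<sigma>(3)] less.prems(1) by simp
    show ?thesis
    proof (rule less.IH[OF _ len])
      show "flow_rank m \<sigma> < n" using less.prems(2) \<sigma> .
      show "flow_rank m \<rho> < flow_rank m \<sigma>" if "facet m \<rho> \<tau>'" "(\<rho>, \<tau>') \<notin> W m" "(\<rho>, \<tau>'') \<in> W m" for \<rho> \<tau>''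
        using flow_rank_descends[OF \<sigma>(3) len that(1) _ that(3)] that(2) \<sigma>(3) by metis
    qed
  qed
  then show ?case
    by (subst mixed_paths_unfold)
       (intro finite_UnI finite_UN_I finite_facets finite_W_above finite_imageI; force)
qed

lemma incidence_square:
  assumes "facet m \<sigma> \<tau>" "length \<tau> = 3"
  shows "incidence \<sigma> \<tau> * incidence \<sigma> \<tau> = 1"
proof -
  obtain x y z where \<tau>: "\<tau> = [x, y, z]"
    using assms(2) by (rule length_3E)
  have tri: "[x, y, z] \<in> all_faces m"
    using assms(1) unfolding \<tau> facet_def by blast
  have "\<sigma> \<in> {[y, z], [x, z], [x, y]}"
    using assms(1) facet_triangle_iff[OF tri] unfolding \<tau> by blast
  then show ?thesis
    using incidence_triangle[OF triangle_distinct[OF tri]] unfolding \<tau> by fastforce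
qed

text \<open>The heart of discrete Morse theory in this dimension. Pushing an edge \<open>\<sigma>\<close> of the boundary of \<open>\<tau>\<close> across
the triangle \<open>\<tau>'\<close> it is paired with replaces \<open>\<sigma>\<close> by the remaining boundary of \<open>\<tau>'\<close>, and this does not
change the value of \<open>F\<close> because \<open>F(\<partial>\<tau>') = 0\<close>. Edges paired with a vertex are lost by the flow, but \<open>F\<close>
is zero there. When the flow stops only critical edges are left, and the coefficient of \<open>\<alpha>\<close> among
them is the sum of the weights of the mixed paths from \<open>\<tau>\<close> to \<open>\<alpha>\<close>.\<close>

lemma morse_flow:
  fixes F :: "face \<Rightarrow> 'r::comm_ring_1"
  assumes down: "\<And>\<rho> \<sigma>. (\<rho>, \<sigma>) \<in> W m \<Longrightarrow> length \<sigma> = 2 \<Longrightarrow> F \<sigma> = 0"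
    and up: "\<And>\<sigma> \<tau>. (\<sigma>, \<tau>) \<in> W m \<Longrightarrow> length \<tau> = 3 \<Longrightarrow> boundary_value m F \<tau> = 0"
    and len: "length \<tau> = 3"
  shows "(\<Sum>\<alpha> \<in> critical m 1. F \<alpha> * of_int (path_sum m \<tau> \<alpha>)) =
    (\<Sum>\<sigma> | facet m \<sigma> \<tau> \<and> (\<sigma>, \<tau>) \<notin> W m. of_int (incidence \<sigma> \<tau>) * F \<sigma>)"
proof -
  define N where "N = Suc (Max (flow_rank m ` faces m 1))"
  have bound: "flow_rank m \<sigma> < N" if "facet m \<sigma> \<tau>" "(\<sigma>, \<tau>) \<notin> W m" "(\<sigma>, \<tau>') \<in> W m" for \<sigma> \<tau>'
  proof -
    have "\<sigma> \<in> faces m 1"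
      using that facet_length[OF that(1)] len by (simp add: faces_Suc_length facet_def)
    then show ?thesis unfolding N_def by (simp add: finite_faces less_Suc_eq_le)
  qed
  show ?thesis
    using len bound
  proof (induction N arbitrary: \<tau> rule: less_induct)
    case (less n)
    let ?C = "critical m 1"
    let ?D = "\<lambda>\<tau>. {\<sigma>. facet m \<sigma> \<tau> \<and> (\<sigma>, \<tau>) \<notin> W m}"
    let ?S = "\<lambda>\<tau>. \<Sum>\<alpha>\<in>?C. F \<alpha> * of_int (path_sum m \<tau> \<alpha>)"
    \<comment> \<open>The induction hypothesis for \<open>\<tau>'\<close>, where the missing term \<open>\<sigma>\<close> of \<open>F(\<partial>\<tau>') = 0\<close> is isolated.\<close>
    have step: "length \<tau>' = 3" "?S \<tau>' = - (of_int (incidence \<sigma> \<tau>') * F \<sigma>)"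
      if \<sigma>: "facet m \<sigma> \<tau>" "(\<sigma>, \<tau>') \<in> W m" "(\<sigma>, \<tau>) \<notin> W m" for \<sigma> \<tau>'
    proof -
      show len': "length \<tau>' = 3"
        using facet_length[OF \<sigma>(1)] W_length[OF \<sigma>(2)] less.prems(1) by simp
      have D: "?D \<tau>' = {\<rho>. facet m \<rho> \<tau>'} - {\<sigma>}"
        using W_down_unique[OF \<sigma>(2) _ len'] \<sigma>(2) by blast
      have "?S \<tau>' = (\<Sum>\<rho>\<in>?D \<tau>'. of_int (incidence \<rho> \<tau>') * F \<rho>)"
      proof (rule less.IH[OF _ len'])
        show "flow_rank m \<sigma> < n" using less.prems(2) \<sigma> by blast
        show "flow_rank m \<rho> < flow_rank m \<sigma>"
          if "facet m \<rho> \<tau>'" "(\<rho>, \<tau>') \<notin> W m" "(\<rho>, \<tau>'') \<in> W m" for \<rho> \<tau>''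
          using flow_rank_descends[OF \<sigma>(2) len' that(1) _ that(3)] that(2) \<sigma>(2) by metis
      qed
      also have "\<dots> = boundary_value m F \<tau>' - of_int (incidence \<sigma> \<tau>') * F \<sigma>"
        unfolding D boundary_value_def
        using W_facet[OF \<sigma>(2) len'] finite_facets[of m \<tau>' "\<lambda>_. True"]
        by (simp add: sum_diff1)
      also have "\<dots> = - (of_int (incidence \<sigma> \<tau>') * F \<sigma>)"
        using up[OF \<sigma>(2) len'] by simp
      finally show "?S \<tau>' = - (of_int (incidence \<sigma> \<tau>') * F \<sigma>)" .
    qed
    \<comment> \<open>Each edge contributes its own value, whether it is critical, matched upwards or matched downwards.\<close>
    have flow: "(\<Sum>\<alpha>\<in>?C. F \<alpha> * (if \<sigma> = \<alpha> then 1 else 0))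
        - (\<Sum>\<tau>' | (\<sigma>, \<tau>') \<in> W m. of_int (incidence \<sigma> \<tau>') * ?S \<tau>') = F \<sigma>"
      if \<sigma>: "\<sigma> \<in> ?D \<tau>" for \<sigma>
    proof -
      have facet: "facet m \<sigma> \<tau>" and notin: "(\<sigma>, \<tau>) \<notin> W m" using \<sigma> by simp_all
      then have len\<sigma>: "length \<sigma> = 2"
        using facet_length less.prems(1) by fastforce
      have mem: "\<sigma> \<in> faces m 1"
        using facet len\<sigma> by (simp add: faces_Suc_length facet_def)
      have first: "(\<Sum>\<alpha>\<in>?C. F \<alpha> * (if \<sigma> = \<alpha> then 1 else 0)) = (if \<sigma> \<in> ?C then F \<sigma> else 0)"
        by (simp add: finite_critical if_distrib cong: if_cong)
      consider (critical) "\<sigma> \<in> ?C" | (up) \<tau>' where "(\<sigma>, \<tau>') \<in> W m"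
        | (down) \<rho> where "(\<rho>, \<sigma>) \<in> W m" "\<And>\<tau>'. (\<sigma>, \<tau>') \<notin> W m"
        using mem unfolding critical_def by blast
      then show ?thesis
      proof cases
        case critical
        then have "{\<tau>'. (\<sigma>, \<tau>') \<in> W m} = {}" by (simp add: critical_def)
        then show ?thesis unfolding first using critical by simp
      next
        case up
        then have "{\<tau>'. (\<sigma>, \<tau>') \<in> W m} = {\<tau>'}" using W_up_unique[OF _ _ len\<sigma>] by blast
        moreover have "\<sigma> \<notin> ?C" using up by (auto simp: critical_def)
        moreover have "of_int (incidence \<sigma> \<tau>') * (of_int (incidence \<sigma> \<tau>') * F \<sigma>) = F \<sigma>"
          using incidence_square[OF W_facet[OF up step(1)[OF facet up notin]] step(1)[OF facet up notin]]
          by (metis mult.assoc mult_1 of_int_1 of_int_mult)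
        ultimately show ?thesis unfolding first using step(2)[OF facet up notin] by simp
      next
        case down
        then have "{\<tau>'. (\<sigma>, \<tau>') \<in> W m} = {}" "\<sigma> \<notin> ?C" by (auto simp: critical_def)
        then show ?thesis unfolding first using assms(1)[OF down(1) len\<sigma>] by simp
      qed
    qed
    have fin: "finite (mixed_paths m \<tau>' \<alpha>)"
      if "facet m \<sigma> \<tau>" "(\<sigma>, \<tau>) \<notin> W m" "(\<sigma>, \<tau>') \<in> W m" for \<sigma> \<tau>' \<alpha>
    proof (rule mixed_paths_finite[OF step(1)[OF that(1,3,2)]])
      show "flow_rank m \<rho> < flow_rank m \<sigma>"
        if "facet m \<rho> \<tau>'" "(\<rho>, \<tau>') \<notin> W m" "(\<rho>, \<tau>'') \<in> W m" for \<rho> \<tau>''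
        using flow_rank_descends[OF \<open>(\<sigma>, \<tau>') \<in> W m\<close> step(1)[OF \<open>facet m \<sigma> \<tau>\<close> \<open>(\<sigma>, \<tau>') \<in> W m\<close> \<open>(\<sigma>, \<tau>) \<notin> W m\<close>]
            that(1) _ that(3)] that(2) \<open>(\<sigma>, \<tau>') \<in> W m\<close> by metis
    qed
    have "?S \<tau> = (\<Sum>\<alpha>\<in>?C. \<Sum>\<sigma>\<in>?D \<tau>. of_int (incidence \<sigma> \<tau>) *
        (F \<alpha> * (if \<sigma> = \<alpha> then 1 else 0)
         - (\<Sum>\<tau>' | (\<sigma>, \<tau>') \<in> W m. of_int (incidence \<sigma> \<tau>') * (F \<alpha> * of_int (path_sum m \<tau>' \<alpha>)))))"
    proof (rule sum.cong[OF refl])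
      fix \<alpha>
      have "F \<alpha> * of_int (path_sum m \<tau> \<alpha>) = (\<Sum>\<sigma>\<in>?D \<tau>. F \<alpha> * (of_int (incidence \<sigma> \<tau>) *
        ((if \<sigma> = \<alpha> then 1 else 0) - (\<Sum>\<tau>' | (\<sigma>, \<tau>') \<in> W m. of_int (incidence \<sigma> \<tau>') * of_int (path_sum m \<tau>' \<alpha>)))))"
        by (subst path_sum_unfold) (erule (2) fin, simp add: sum_distrib_left if_distrib[where f = of_int] cong: if_cong)
      also have "\<dots> = (\<Sum>\<sigma>\<in>?D \<tau>. of_int (incidence \<sigma> \<tau>) *
        (F \<alpha> * (if \<sigma> = \<alpha> then 1 else 0)
         - (\<Sum>\<tau>' | (\<sigma>, \<tau>') \<in> W m. of_int (incidence \<sigma> \<tau>') * (F \<alpha> * of_int (path_sum m \<tau>' \<alpha>)))))"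
        by (intro sum.cong refl) (simp add: sum_distrib_left algebra_simps)
      finally show "F \<alpha> * of_int (path_sum m \<tau> \<alpha>) = \<dots>" .
    qed
    also have "\<dots> = (\<Sum>\<sigma>\<in>?D \<tau>. of_int (incidence \<sigma> \<tau>) * ((\<Sum>\<alpha>\<in>?C. F \<alpha> * (if \<sigma> = \<alpha> then 1 else 0))
        - (\<Sum>\<tau>' | (\<sigma>, \<tau>') \<in> W m. of_int (incidence \<sigma> \<tau>') * ?S \<tau>')))"
      apply (subst sum.swap)
      apply (rule sum.cong[OF refl])
      apply (subst sum_distrib_left[symmetric])
      apply (subst sum_subtractf)
      apply (subst sum.swap)
      apply (simp only: sum_distrib_left)
      done
    also have "\<dots> = (\<Sum>\<sigma>\<in>?D \<tau>. of_int (incidence \<sigma> \<tau>) * F \<sigma>)"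
      by (intro sum.cong refl arg_cong2[of _ _ _ _ "(*)"] flow)
    finally show ?case .
  qed
qed

section \<open>Critical edges and triangles\<close>

lemma W_lower_length: "(\<sigma>, \<tau>) \<in> W m \<Longrightarrow> length \<sigma> \<le> 2"
  unfolding W_def by clarify (erule W_pairing.cases; simp)

lemma W_below_edge_iff:
  "(\<exists>\<rho>. (\<rho>, [(a, b), (c, d)]) \<in> W m) \<longleftrightarrow> [(a, b), (c, d)] \<in> all_faces m \<and>
     (c = m \<and> d = m - 1 \<or> b = m \<and> c = m - 1 \<and> d = m \<or> a = m - 1 \<and> b = m - 2 \<and> c = m - 1 \<and> d = m)"
  (is "?L \<longleftrightarrow> ?R")
proof
  assume ?L
  then obtain \<rho> where \<rho>: "(\<rho>, [(a, b), (c, d)]) \<in> W m" ..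
  obtain p q where pq: "\<rho> = [(p, q)]"
    using W_length[OF \<rho>] by (cases \<rho>) auto
  show ?R using \<rho> unfolding pq W_vertex_iff by auto
next
  assume R: ?R
  have range: "1 \<le> a" "1 \<le> b" "a \<le> m" "b \<le> m" "a \<noteq> b" "a \<le> c" "b \<le> d" "a < c \<or> b < d"
    using R unfolding edge_iff by auto
  from R have face: "[(a, b), (c, d)] \<in> all_faces m" by blast
  from R consider "c = m \<and> d = m - 1" | "b = m \<and> c = m - 1 \<and> d = m"
    | "a = m - 1 \<and> b = m - 2 \<and> c = m - 1 \<and> d = m" by blast
  then show ?L
  proof cases
    case 1
    then have "b < m - 1 \<or> a < m - 1 \<and> b = m - 1" using range by linarith
    then have "([(a, b)], [(a, b), (c, d)]) \<in> W m"
      using face range 1 unfolding W_vertex_iff vertex_iff by simp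
    then show ?thesis ..
  next
    case 2
    then have "a < m - 1" using range by linarith
    then have "([(a, b)], [(a, b), (c, d)]) \<in> W m"
      using face range 2 unfolding W_vertex_iff vertex_iff by simp
    then show ?thesis ..
  next
    case 3
    have m: "1 \<le> m - 1" "1 \<le> m" "m - 1 \<noteq> m" using range 3 by linarith+
    from 3 have "([(m - 1, m)], [(a, b), (c, d)]) \<in> W m"
      using face 3 m unfolding W_vertex_iff vertex_iff by simp
    then show ?thesis ..
  qed
qed

text \<open>The cases (a) to (f) leave three kinds of edges: those ending in the vertex \<open>(m - 1, m)\<close>, those ending
in \<open>(m, m - 1)\<close>, and those whose upper or lower entries are both \<open>m\<close>. The pairings with vertices
use up the second kind, and the edges of the first kind that start in \<open>(m - 1, m - 2)\<close> or have lower
entries \<open>m\<close>.\<close>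

lemma critical_edge_iff:
  "[(a, b), (c, d)] \<in> critical m 1 \<longleftrightarrow> [(a, b), (c, d)] \<in> all_faces m \<and>
     (c = m - 1 \<and> d = m \<and> b < m \<and> \<not> (a = m - 1 \<and> b = m - 2) \<or>
      a = m \<and> c = m \<and> d < m - 1 \<or> b = m \<and> d = m \<and> c < m - 1)"
proof (cases "[(a, b), (c, d)] \<in> all_faces m")
  case True
  let ?above = "a = c \<and> a < m \<and> d < m \<or> a = c \<and> a < m - 1 \<and> d = m \<or>
     b = d \<and> b < m \<and> c < m \<or> b = d \<and> b < m - 1 \<and> c = m \<or>
     a < c \<and> b < d \<and> b \<noteq> c \<and> (c < m \<and> d < m \<or> c = m \<and> d + 1 < m) \<or>
     a < c \<and> b < d \<and> a \<noteq> d \<and> (b = c \<and> c < m \<and> d < m \<or> c + 1 < m \<and> d = m)"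
  let ?below = "c = m \<and> d = m - 1 \<or> b = m \<and> c = m - 1 \<and> d = m \<or>
     a = m - 1 \<and> b = m - 2 \<and> c = m - 1 \<and> d = m"
  let ?shape = "c = m - 1 \<and> d = m \<and> b < m \<and> \<not> (a = m - 1 \<and> b = m - 2) \<or>
      a = m \<and> c = m \<and> d < m - 1 \<or> b = m \<and> d = m \<and> c < m - 1"
  have above: "(\<exists>\<tau>. ([(a, b), (c, d)], \<tau>) \<in> W m) \<longleftrightarrow> ?above"
    using True by (simp only: W_edge_iff ex_disj_distrib ex_simps simp_thms)
  have "[(a, b), (c, d)] \<in> critical m 1 \<longleftrightarrow>
      \<not> (\<exists>\<tau>. ([(a, b), (c, d)], \<tau>) \<in> W m) \<and> \<not> (\<exists>\<rho>. (\<rho>, [(a, b), (c, d)]) \<in> W m)"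
    using True unfolding critical_def by (auto simp: faces_Suc_length)
  then have critical: "[(a, b), (c, d)] \<in> critical m 1 \<longleftrightarrow> \<not> ?above \<and> \<not> ?below"
    using True by (simp only: above W_below_edge_iff simp_thms)
  have range: "1 \<le> a" "1 \<le> b" "a \<noteq> b" "c \<noteq> d" "a \<le> c" "b \<le> d" "c \<le> m" "d \<le> m" "a < c \<or> b < d"
    using True unfolding edge_iff by blast+
  have cover: "?above \<or> ?below \<or> ?shape"
  proof (cases "d = m")
    case d: True
    show ?thesis
    proof (cases "c = m - 1")
      case True
      then show ?thesis using d range(6) by (cases "b = m") auto
    next
      case False
      then have "c < m - 1" "c < m" using d range(4,7) by linarith+
      then show ?thesis using d range(5,6) by (cases "a = c"; cases "b = m") auto
    qed
  next
    case False
    then have d: "d < m" using range(8) by simp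
    show ?thesis
    proof (cases "c = m")
      case c: True
      show ?thesis
      proof (cases "d = m - 1")
        case False
        then have "d < m - 1" "d + 1 < m" using d by linarith+
        then show ?thesis using c d range(4-6) by (cases "a = m"; cases "b = d") auto
      qed (use c in blast)
    next
      case False
      then have "c < m" using range(7) by simp
      then show ?thesis using d range(5,6)
        by (cases "a = c"; cases "b = d"; cases "b = c"; cases "a = d") auto
    qed
  qed
  have excl: "\<not> ?above" "\<not> ?below" if shape: ?shape
  proof -
    from shape consider "c = m - 1" "d = m" "b < m" "\<not> (a = m - 1 \<and> b = m - 2)"
      | "a = m" "c = m" "d < m - 1" | "b = m" "d = m" "c < m - 1" by blast
    then have "\<not> ?above \<and> \<not> ?below"
    proof cases
      case 1
      then show ?thesis using range(1,3,9) by auto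
    next
      case 2
      then show ?thesis using range(1,3,9) by auto
    next
      case 3
      then show ?thesis using range(1,3,9) by auto
    qed
    then show "\<not> ?above" "\<not> ?below" by (rule conjunct1, rule conjunct2)
  qed
  have logic: "X \<longleftrightarrow> T \<and> S"
    if "X \<longleftrightarrow> \<not> A \<and> \<not> B" "A \<or> B \<or> S" "S \<Longrightarrow> \<not> A" "S \<Longrightarrow> \<not> B" T for X T S A B
    using that by blast
  show ?thesis by (rule logic[OF critical cover excl True])
next
  case False
  then show ?thesis by (simp add: critical_def faces_Suc_length)
qed

text \<open>Triangles whose upper row jumps first are all matched by (c), (d) or (e). Those whose lower row
jumps first are matched by (a), (b) or (f) if an entry is \<open>m\<close>, and by (f) if the first lower entry
equals the last upper one.\<close>

lemma critical_triangle_iff: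
  "[(a, b), (c, d), (e, f)] \<in> critical m 2 \<longleftrightarrow> [(a, b), (c, d), (e, f)] \<in> all_faces m \<and>
     a = c \<and> d = f \<and> b \<noteq> e \<and> e < m \<and> d < m" (is "?\<tau> \<in> _ \<longleftrightarrow> _")
proof (cases "?\<tau> \<in> all_faces m")
  case True
  have up: "(?\<tau>, \<tau>') \<notin> W m" for \<tau>' using W_lower_length[of ?\<tau> \<tau>' m] by auto
  have range: "1 \<le> a" "e \<le> m" "1 \<le> b" "f \<le> m" "a \<noteq> b" "c \<noteq> d" "e \<noteq> f" "a < e" "b < f"
    "a = c \<and> d = f \<or> c = e \<and> b = d"
    using True unfolding triangle_iff by auto
  have faces: "[(a, b), (c, d)] \<in> all_faces m" "[(a, b), (e, f)] \<in> all_faces m"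
    using range unfolding edge_iff by auto
  have "(\<exists>\<rho>. (\<rho>, ?\<tau>) \<in> W m) \<longleftrightarrow> \<not> (a = c \<and> d = f \<and> b \<noteq> e \<and> e < m \<and> d < m)"
  proof
    assume "\<exists>\<rho>. (\<rho>, ?\<tau>) \<in> W m"
    then obtain \<rho> where \<rho>: "(\<rho>, ?\<tau>) \<in> W m" ..
    obtain p q r s where pq: "\<rho> = [(p, q), (r, s)]"
      using W_length[OF \<rho>] length_2E[of \<rho>] by fastforce
    show "\<not> (a = c \<and> d = f \<and> b \<noteq> e \<and> e < m \<and> d < m)"
      using \<rho> range(8,9) unfolding pq W_edge_iff
      apply (intro notI)
      apply (elim conjE disjE)
      apply (simp_all only: list.inject prod.inject simp_thms)
      done
  next
    assume not_shape: "\<not> (a = c \<and> d = f \<and> b \<noteq> e \<and> e < m \<and> d < m)"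
    show "\<exists>\<rho>. (\<rho>, ?\<tau>) \<in> W m"
    proof (cases "c = e \<and> b = d")
      case True
      then have eqs: "c = e" "b = d" by simp_all
      show ?thesis
      proof (cases "f = m \<or> e = m \<and> f = m - 1")
        case True
        then have "f = m \<and> b < m \<and> e < m \<or> e = m \<and> b < m - 1 \<and> f = m - 1"
          using range(2,4,7,9) eqs by linarith
        then have "([(a, b), (c, d)], ?\<tau>) \<in> W m"
          using faces(1) unfolding W_edge_iff eqs by (elim disjE conjE) simp_all
        then show ?thesis ..
      next
        case False
        then have "e < m \<and> f < m \<or> e = m \<and> f + 1 < m"
          using range(2,4) by linarith
        then have "([(a, b), (e, f)], ?\<tau>) \<in> W m"
          using faces(2) range(6,8,9) unfolding W_edge_iff eqs by simp
        then show ?thesis ..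
      qed
    next
      case False
      then have eqs: "a = c" "d = f" using range(10) by blast+
      show ?thesis
      proof (cases "e = m \<or> e = m - 1 \<and> f = m")
        case True
        then have "e = m \<and> a < m \<and> f < m \<or> e = m - 1 \<and> a < m - 1 \<and> f = m"
          using range(2,4,7,8) by linarith
        then have "([(a, b), (c, d)], ?\<tau>) \<in> W m"
          using faces(1) unfolding W_edge_iff eqs by (elim disjE conjE) simp_all
        then show ?thesis ..
      next
        case False
        then have "e < m" using range(2) by linarith
        then have "b = e \<and> e < m \<and> f < m \<or> e + 1 < m \<and> f = m"
          using False not_shape eqs range(4) by (cases "f = m") auto
        then have "([(a, b), (e, f)], ?\<tau>) \<in> W m"
          using faces(2) range(6,8,9) unfolding W_edge_iff eqs by simp
        then show ?thesis ..
      qed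
    qed
  qed
  then show ?thesis using True up unfolding critical_def faces_Suc_length by auto
next
  case False
  then show ?thesis by (simp add: critical_def faces_Suc_length)
qed

section \<open>The cocycle condition as a four-term relation\<close>

lemma sum_fun_apply:
  "(\<Sum>i\<in>A. g i) x = (\<Sum>i\<in>A. g i x)"
  for g :: "'i \<Rightarrow> 'a \<Rightarrow> 'r::comm_monoid_add"
  by (induction A rule: infinite_finite_induct) auto

text \<open>The coefficients at the ordered symbols \<open>{a, b}\<close>, seen as the entries of a square matrix without its
diagonal.\<close>

definition cell :: "nat \<Rightarrow> (face \<Rightarrow> 'r::comm_ring_1) \<Rightarrow> nat \<Rightarrow> nat \<Rightarrow> 'r" where
  "cell m f a b = f [(a, b), (m - 1, m)]"

text \<open>The simplicial cochain determined by the values of \<open>f\<close> on critical edges. Solving the equations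
\<open>F(\<partial>\<tau>) = 0\<close> for the matched triangles, in the order of increasing \<open>flow_rank\<close> of the matched edge,
gives this closed form. The two terms besides the cells come from critical edges whose lower,
respectively upper, entries are both \<open>m\<close>. The cells enter when the upper entry changes from \<open>a\<close> to \<open>c\<close>,
which happens next to the lower entry \<open>b\<close>, or next to \<open>d\<close> when \<open>b = c\<close> forbids the vertex \<open>(c, b)\<close>.
Degenerate and non-critical arrays need no separate treatment, since a Morse cochain vanishes there.\<close>

definition extend_cochain :: "nat \<Rightarrow> (face \<Rightarrow> 'r::comm_ring_1) \<Rightarrow> face \<Rightarrow> 'r" where
  "extend_cochain m f \<sigma> = (case \<sigma> of [(a, b), (c, d)] \<Rightarrow>
     (if d = m then cell m f a b + f [(a, m), (c, m)]
      else if c = m then f [(m, b), (m, d)]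
      else (if b = c then cell m f a d - cell m f c d else cell m f a b - cell m f c b)
           + f [(a, m), (c, m)] + f [(m, b), (m, d)])
   | _ \<Rightarrow> 0)"

lemma extend_cochain_edge:
  "extend_cochain m f [(a, b), (c, d)] =
     (if d = m then cell m f a b + f [(a, m), (c, m)]
      else if c = m then f [(m, b), (m, d)]
      else (if b = c then cell m f a d - cell m f c d else cell m f a b - cell m f c b)
           + f [(a, m), (c, m)] + f [(m, b), (m, d)])"
  by (simp add: extend_cochain_def)

context
  fixes m :: nat and f :: "face \<Rightarrow> 'r::comm_ring_1"
  assumes f: "f \<in> morse_cochains m 1"
begin

lemma noncritical_zero: "\<sigma> \<notin> critical m 1 \<Longrightarrow> f \<sigma> = 0"
  using f by (simp add: morse_cochains_def)

text \<open>The arrays at which the closed form evaluates \<open>f\<close> although they are degenerate or paired.\<close>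

lemma cochain_zero_rules:
  "f [(a, m), (a, m)] = 0" "f [(m, b), (m, b)] = 0"
  "f [(a, m), (m - 1, m)] = 0" "f [(m, b), (m, m - 1)] = 0"
  "cell m f a m = 0" "cell m f (m - 1) (m - 2) = 0"
proof -
  have "[(m - 1, m - 2), (m - 1, m)] \<notin> critical m 1"
    unfolding critical_edge_iff edge_iff by auto
  then show "cell m f (m - 1) (m - 2) = 0" unfolding cell_def by (rule noncritical_zero)
  show "f [(a, m), (m - 1, m)] = 0" "cell m f a m = 0"
    unfolding cell_def by (rule noncritical_zero; simp add: critical_edge_iff del: One_nat_def)+
qed (rule noncritical_zero; simp add: critical_edge_iff edge_iff del: One_nat_def)+

lemma extend_cochain_critical:
  assumes "\<sigma> \<in> critical m 1"
  shows "extend_cochain m f \<sigma> = f \<sigma>"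
proof -
  have "length \<sigma> = 2"
    using assms by (simp add: critical_def faces_Suc_length)
  then obtain a b c d where \<sigma>: "\<sigma> = [(a, b), (c, d)]"
    by (rule length_2E)
  have "c \<noteq> d"
    using assms unfolding \<sigma> critical_edge_iff edge_iff by blast
  have "c = m - 1 \<and> d = m \<or> a = m \<and> c = m \<and> d < m - 1 \<or> b = m \<and> d = m \<and> c < m - 1"
    using assms unfolding \<sigma> critical_edge_iff by blast
  then show ?thesis
    unfolding \<sigma> extend_cochain_edge using cochain_zero_rules \<open>c \<noteq> d\<close>
    by (elim disjE conjE) (simp_all add: cell_def)
qed

lemma extend_cochain_W_below:
  assumes "(\<rho>, \<sigma>) \<in> W m" "length \<sigma> = 2"
  shows "extend_cochain m f \<sigma> = 0"
proof -
  obtain a b c d where \<sigma>: "\<sigma> = [(a, b), (c, d)]"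
    using assms(2) by (rule length_2E)
  have "c \<noteq> d" "c = m \<and> d = m - 1 \<or> b = m \<and> c = m - 1 \<and> d = m
      \<or> a = m - 1 \<and> b = m - 2 \<and> c = m - 1 \<and> d = m"
    using assms(1) W_below_edge_iff[of a b c d m] unfolding \<sigma> edge_iff by blast+
  then show ?thesis
    unfolding \<sigma> extend_cochain_edge using cochain_zero_rules by (elim disjE conjE) simp_all
qed

lemma extend_cochain_W_above:
  assumes "(\<sigma>, \<tau>) \<in> W m" "length \<tau> = 3"
  shows "boundary_value m (extend_cochain m f) \<tau> = 0"
proof -
  obtain a b c d where \<sigma>: "\<sigma> = [(a, b), (c, d)]"
    using W_length[OF assms(1)] assms(2) length_2E[of \<sigma>] by fastforce
  have \<tau>: "\<tau> \<in> all_faces m" using assms(1) by (simp add: W_def)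
  have range: "a \<noteq> b" "c \<noteq> d"
    using assms(1) unfolding \<sigma> W_edge_iff edge_iff by blast+
  from assms(1)[unfolded \<sigma> W_edge_iff, THEN conjunct2] show ?thesis
  proof (elim disjE, goal_cases)
    case 1
    then show ?case using cochain_zero_rules range \<tau>
      by (simp add: boundary_value_triangle extend_cochain_edge del: One_nat_def)
  next
    case 2
    then show ?case using cochain_zero_rules range \<tau>
      by (simp add: boundary_value_triangle extend_cochain_edge del: One_nat_def)
  next
    case 3
    then show ?case using cochain_zero_rules range \<tau>
      by (simp add: boundary_value_triangle extend_cochain_edge del: One_nat_def)
  next
    case 4
    then have "m - 1 \<noteq> m" by linarith
    with 4 show ?case using cochain_zero_rules range \<tau>
      by (simp add: boundary_value_triangle extend_cochain_edge del: One_nat_def)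
  next
    case 5
    then show ?case using cochain_zero_rules range \<tau>
      by (elim conjE disjE) (simp_all add: boundary_value_triangle extend_cochain_edge del: One_nat_def)
  next
    case 6
    then show ?case using cochain_zero_rules range \<tau>
      by (elim conjE disjE) (simp_all add: boundary_value_triangle extend_cochain_edge del: One_nat_def)
  qed
qed

text \<open>A critical triangle is not matched, so \<open>morse_flow\<close> produces its full boundary.\<close>

lemma coboundary_eq:
  "morse_coboundary m 1 f \<beta> = (if \<beta> \<in> critical m 2 then boundary_value m (extend_cochain m f) \<beta> else 0)"
proof -
  have "morse_coboundary m 1 f \<beta> = (\<Sum>\<alpha>\<in>critical m 1. f \<alpha> *
      (\<Sum>\<tau>\<in>critical m 2. of_int (path_sum m \<tau> \<alpha>) * (if \<beta> = \<tau> then 1 else 0)))"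
    by (simp add: morse_coboundary_def sum_fun_apply scale_fun_def dual_def path_sum_def numeral_2_eq_2)
  also have "\<dots> = (if \<beta> \<in> critical m 2 then \<Sum>\<alpha>\<in>critical m 1. f \<alpha> * of_int (path_sum m \<beta> \<alpha>) else 0)"
    by (simp add: finite_critical if_distrib cong: if_cong)
  also have "\<dots> = (if \<beta> \<in> critical m 2 then boundary_value m (extend_cochain m f) \<beta> else 0)"
  proof (cases "\<beta> \<in> critical m 2")
    case True
    then have len: "length \<beta> = 3" and unpaired: "\<And>\<sigma>. (\<sigma>, \<beta>) \<notin> W m"
      by (auto simp: critical_def faces_Suc_length)
    have "(\<Sum>\<alpha>\<in>critical m 1. f \<alpha> * of_int (path_sum m \<beta> \<alpha>))
        = (\<Sum>\<alpha>\<in>critical m 1. extend_cochain m f \<alpha> * of_int (path_sum m \<beta> \<alpha>))"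
      by (intro sum.cong refl) (simp add: extend_cochain_critical)
    also have "\<dots> = boundary_value m (extend_cochain m f) \<beta>"
      using morse_flow[OF extend_cochain_W_below extend_cochain_W_above len] unpaired
      by (simp add: boundary_value_def)
    finally show ?thesis using True by simp
  qed simp
  finally show ?thesis .
qed

text \<open>The contributions of the critical edges with two upper or two lower entries \<open>m\<close> cancel, so that only
the cells at the four pairs in \<open>{a, c} \<times> {b, d}\<close> remain.\<close>

lemma coboundary_critical:
  assumes "[(a, b), (a, d), (c, d)] \<in> critical m 2"
  shows "morse_coboundary m 1 f [(a, b), (a, d), (c, d)]
    = (cell m f a d + cell m f c b) - (cell m f a b + cell m f c d)"
proof -
  have shape: "[(a, b), (a, d), (c, d)] \<in> all_faces m" "b \<noteq> c" "c < m" "d < m"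
    using assms unfolding critical_triangle_iff by blast+
  have "a \<noteq> b" "a \<noteq> d" "c \<noteq> d" "a < c"
    using shape(1) unfolding triangle_iff by blast+
  with shape assms show ?thesis
    using cochain_zero_rules
    by (simp add: coboundary_eq boundary_value_triangle extend_cochain_edge del: One_nat_def)
qed

end

lemma morse_cocycle_iff:
  fixes f :: "face \<Rightarrow> 'r::comm_ring_1"
  shows "f \<in> morse_cocycles m 1 \<longleftrightarrow> f \<in> morse_cochains m 1 \<and>
    (\<forall>a b c d. 1 \<le> a \<and> a < c \<and> c < m \<and> 1 \<le> b \<and> b < d \<and> d < m \<and> {a, c} \<inter> {b, d} = {} \<longrightarrow>
      cell m f a b + cell m f c d = cell m f a d + cell m f c b)"
proof (cases "f \<in> morse_cochains m 1")
  case f: True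
  have crit: "[(a, b), (a, d), (c, d)] \<in> critical m 2 \<longleftrightarrow>
    1 \<le> a \<and> a < c \<and> c < m \<and> 1 \<le> b \<and> b < d \<and> d < m \<and> {a, c} \<inter> {b, d} = {}" for a b c d
    unfolding critical_triangle_iff triangle_iff by auto
  have "morse_coboundary m 1 f = 0 \<longleftrightarrow>
    (\<forall>a b c d. [(a, b), (a, d), (c, d)] \<in> critical m 2 \<longrightarrow>
      cell m f a b + cell m f c d = cell m f a d + cell m f c b)"
  proof
    assume zero: "morse_coboundary m 1 f = 0"
    show "\<forall>a b c d. [(a, b), (a, d), (c, d)] \<in> critical m 2 \<longrightarrow>
      cell m f a b + cell m f c d = cell m f a d + cell m f c b"
    proof (intro allI impI)
      fix a b c d
      assume "[(a, b), (a, d), (c, d)] \<in> critical m 2"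
      from coboundary_critical[OF f this] show
        "cell m f a b + cell m f c d = cell m f a d + cell m f c b"
        unfolding zero by simp
    qed
  next
    assume rel: "\<forall>a b c d. [(a, b), (a, d), (c, d)] \<in> critical m 2 \<longrightarrow>
      cell m f a b + cell m f c d = cell m f a d + cell m f c b"
    show "morse_coboundary m 1 f = 0"
    proof
      fix \<beta>
      show "morse_coboundary m 1 f \<beta> = 0 \<beta>"
      proof (cases "\<beta> \<in> critical m 2")
        case True
        then have "length \<beta> = 3" by (simp add: critical_def faces_Suc_length)
        then obtain a b c' d' c d where "\<beta> = [(a, b), (c', d'), (c, d)]" by (rule length_3E)
        with True have \<beta>: "\<beta> = [(a, b), (a, d), (c, d)]" by (simp add: critical_triangle_iff)
        show ?thesis
          unfolding \<beta> coboundary_critical[OF f True[unfolded \<beta>]]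
          using rel[rule_format, OF True[unfolded \<beta>]] by simp
      qed (simp add: coboundary_eq[OF f] del: One_nat_def)
    qed
  qed
  then show ?thesis using f unfolding morse_cocycles_def crit by simp
qed (simp add: morse_cocycles_def)

section \<open>Families dual to evaluation points\<close>

text \<open>If a finite family in a submodule is dual to a set of points, and these points separate the
submodule, then \<open>f = (\<Sum>i. f(e i) \<cdot> v i)\<close> for each element \<open>f\<close> of it. No coefficient
has to be inverted, so this works over every commutative ring.\<close>

lemma basis_family_dual_points:
  fixes v :: "'i \<Rightarrow> 'a \<Rightarrow> 'r::comm_ring_1"
  assumes fin: "finite I"
    and sub: "fun_module.subspace M"
    and mem: "\<And>i. i \<in> I \<Longrightarrow> v i \<in> M"
    and dual: "\<And>i j. i \<in> I \<Longrightarrow> j \<in> I \<Longrightarrow> v i (e j) = (if i = j then 1 else 0)"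
    and det: "\<And>f. f \<in> M \<Longrightarrow> (\<And>i. i \<in> I \<Longrightarrow> f (e i) = 0) \<Longrightarrow> f = 0"
  shows "basis_family I v M"
proof -
  have inj: "inj_on v I"
  proof (rule inj_onI)
    fix i j assume ij: "i \<in> I" "j \<in> I" "v i = v j"
    then have "(if j = i then 1 else 0 :: 'r) = 1"
      using dual[of i i] dual[of j i] by simp
    then show "i = j" by (simp split: if_splits)
  qed
  have comb: "(\<Sum>i\<in>I. scale_fun (c i) (v i)) (e j) = c j" if "j \<in> I" for c j
  proof -
    have "(\<Sum>i\<in>I. scale_fun (c i) (v i)) (e j) = (\<Sum>i\<in>I. if i = j then c i else 0)"
      unfolding sum_fun_apply scale_fun_def
      by (rule sum.cong[OF refl]) (simp add: dual that)
    then show ?thesis using that fin by simp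
  qed
  have "fun_module.independent (v ` I)"
    unfolding fun_module.dependent_finite[OF finite_imageI[OF fin]]
  proof (intro notI, elim exE conjE bexE)
    fix u w assume w: "w \<in> v ` I" "u w \<noteq> 0" "(\<Sum>x\<in>v ` I. scale_fun (u x) x) = 0"
    then obtain j where j: "j \<in> I" "w = v j" by blast
    have "(\<Sum>x\<in>v ` I. scale_fun (u x) x) = (\<Sum>i\<in>I. scale_fun (u (v i)) (v i))"
      using inj by (simp add: sum.reindex)
    with w(3) comb[OF j(1), of "\<lambda>i. u (v i)"] have "u (v j) = 0" by simp
    with w j show False by simp
  qed
  moreover have "fun_module.span (v ` I) = M"
  proof
    show "fun_module.span (v ` I) \<subseteq> M"
      using mem sub by (intro fun_module.span_minimal) auto
    show "M \<subseteq> fun_module.span (v ` I)"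
    proof
      fix f assume f: "f \<in> M"
      let ?g = "\<Sum>i\<in>I. scale_fun (f (e i)) (v i)"
      have "?g \<in> M"
        by (intro fun_module.subspace_sum[OF sub] fun_module.subspace_scale[OF sub] mem)
      then have "f - ?g \<in> M" using f fun_module.subspace_diff[OF sub] by blast
      then have "f - ?g = 0" by (rule det) (simp add: comb)
      then have "f = ?g" by simp
      also have "\<dots> \<in> fun_module.span (v ` I)"
        by (intro fun_module.span_sum fun_module.span_scale fun_module.span_base) simp
      finally show "f \<in> fun_module.span (v ` I)" .
    qed
  qed
  ultimately show ?thesis using inj unfolding basis_family_def by blast
qed

lemma morse_cochains_subspace: "fun_module.subspace (morse_cochains m p)"
  unfolding fun_module.subspace_def by (auto simp: morse_cochains_def scale_fun_def)

lemma cell_add: "cell m (f + g) i j = cell m f i j + cell m g i j"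
  by (simp add: cell_def)

lemma cell_diff: "cell m (f - g) i j = cell m f i j - cell m g i j"
  by (simp add: cell_def)

lemma cell_scale: "cell m (scale_fun r f) i j = r * cell m f i j"
  by (simp add: cell_def scale_fun_def)

lemma morse_cocycles_subspace: "fun_module.subspace (morse_cocycles m 1 :: (face \<Rightarrow> 'r::comm_ring_1) set)"
proof -
  have cochain: "f \<in> morse_cochains m 1" if "f \<in> morse_cocycles m 1" for f :: "face \<Rightarrow> 'r"
    using that unfolding morse_cocycle_iff by (rule conjunct1)
  note rel = morse_cocycle_iff[THEN iffD1, THEN conjunct2, rule_format]
  show ?thesis unfolding fun_module.subspace_def
  proof (intro conjI ballI allI)
    show "0 \<in> morse_cocycles m 1"
      unfolding morse_cocycle_iff using fun_module.subspace_0[OF morse_cochains_subspace]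
      by (simp add: cell_def)
  next
    fix f g :: "face \<Rightarrow> 'r" assume f: "f \<in> morse_cocycles m 1" and g: "g \<in> morse_cocycles m 1"
    have A: "f + g \<in> morse_cochains m 1"
      by (rule fun_module.subspace_add[OF morse_cochains_subspace cochain[OF f] cochain[OF g]])
    have B: "cell m (f + g) a b + cell m (f + g) c d = cell m (f + g) a d + cell m (f + g) c b"
      if "1 \<le> a \<and> a < c \<and> c < m \<and> 1 \<le> b \<and> b < d \<and> d < m \<and> {a, c} \<inter> {b, d} = {}" for a b c d
    proof -
      have "cell m f a b + cell m f c d = cell m f a d + cell m f c b"
        "cell m g a b + cell m g c d = cell m g a d + cell m g c b"
        by (rule rel[OF f that], rule rel[OF g that])
      then have "(cell m f a b + cell m f c d) + (cell m g a b + cell m g c d)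
        = (cell m f a d + cell m f c b) + (cell m g a d + cell m g c b)" by simp
      then show ?thesis unfolding cell_add by (simp only: ac_simps)
    qed
    show "f + g \<in> morse_cocycles m 1" unfolding morse_cocycle_iff
    proof (intro conjI allI impI A)
      fix a b c d
      assume "1 \<le> a \<and> a < c \<and> c < m \<and> 1 \<le> b \<and> b < d \<and> d < m \<and> {a, c} \<inter> {b, d} = {}"
      then show "cell m (f + g) a b + cell m (f + g) c d = cell m (f + g) a d + cell m (f + g) c b"
        by (rule B)
    qed
  next
    fix r and f :: "face \<Rightarrow> 'r" assume f: "f \<in> morse_cocycles m 1"
    have "scale_fun r f \<in> morse_cochains m 1"
      by (rule fun_module.subspace_scale[OF morse_cochains_subspace cochain[OF f]])
    then show "scale_fun r f \<in> morse_cocycles m 1"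
      unfolding morse_cocycle_iff cell_scale distrib_left[symmetric]
    proof (intro conjI allI impI arg_cong[where f = "(*) r"])
      fix a b c d
      assume "1 \<le> a \<and> a < c \<and> c < m \<and> 1 \<le> b \<and> b < d \<and> d < m \<and> {a, c} \<inter> {b, d} = {}"
      then show "cell m f a b + cell m f c d = cell m f a d + cell m f c b"
        by (rule rel[OF f])
    qed
  qed
qed

text \<open>The mixed second difference of a function of one variable is zero.\<close>

lemma cocycle_if_additive:
  fixes f :: "face \<Rightarrow> 'r::comm_ring_1"
  assumes "f \<in> morse_cochains m 1"
    and "\<And>i j. 1 \<le> i \<Longrightarrow> i < m \<Longrightarrow> 1 \<le> j \<Longrightarrow> j < m \<Longrightarrow> i \<noteq> j \<Longrightarrow> cell m f i j = x i + y j"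
  shows "f \<in> morse_cocycles m 1"
  unfolding morse_cocycle_iff
proof (intro conjI allI impI assms(1))
  fix a b c d
  assume "1 \<le> a \<and> a < c \<and> c < m \<and> 1 \<le> b \<and> b < d \<and> d < m \<and> {a, c} \<inter> {b, d} = {}"
  then have *: "1 \<le> a" "a < m" "1 \<le> c" "c < m" "1 \<le> b" "b < m" "1 \<le> d" "d < m"
    "a \<noteq> b" "a \<noteq> d" "c \<noteq> b" "c \<noteq> d" by simp_all
  have "cell m f a b = x a + y b" "cell m f c d = x c + y d"
    "cell m f a d = x a + y d" "cell m f c b = x c + y b"
    by (rule assms(2); rule *)+
  then show "cell m f a b + cell m f c d = cell m f a d + cell m f c b" by (simp add: algebra_simps)
qed

lemma basis_pairs_iff:
  assumes "m \<ge> 5"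
  shows "(a, b) \<in> basis_pairs m \<longleftrightarrow> b = m - 1 \<and> 1 \<le> a \<and> a < m - 1
    \<or> a = m - 1 \<and> 1 \<le> b \<and> b < m - 2 \<or> a = m - 2 \<and> b = m - 3" (is "?L \<longleftrightarrow> ?R")
proof
  assume L: ?L
  then have *: "1 \<le> a" "a < m" "1 \<le> b" "b < m" "b \<noteq> a" "\<not> (a = m - 1 \<and> b = m - 2)"
    unfolding basis_pairs_def symb_pairs_def by simp_all
  from L consider "a = m - 1" | "b = m - 1" | "a = m - 2 \<and> b = m - 3"
    unfolding basis_pairs_def by auto
  then show ?R
  proof cases
    case 1
    then have "b < m - 2" using * by linarith
    then show ?thesis using * 1 by blast
  next
    case 2
    then have "a < m - 1" using * by linarith
    then show ?thesis using * 2 by blast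
  qed blast
next
  assume ?R
  then have "1 \<le> a \<and> a < m \<and> 1 \<le> b \<and> b < m \<and> b \<noteq> a"
    "\<not> (a = m - 1 \<and> b = m - 2)" "a = m - 1 \<or> b = m - 1 \<or> a = m - 2 \<and> b = m - 3"
    using assms by (elim disjE; simp; linarith)+
  then show ?L unfolding basis_pairs_def symb_pairs_def by simp
qed

text \<open>Write \<open>n = m - 1\<close>. If row and column \<open>n\<close> of the matrix of cells vanish, then the relations for squares
with one side there show that the cells with both indices below \<open>n\<close> are constant along rows and along
columns. The matrix of these cells has size at least \<open>3\<close>, so alternating row and column moves connect
each of them to the cell \<open>(n - 1, n - 2)\<close>, which belongs to the basis.\<close>

lemma cocycle_zero_if_zero_on_basis_points:
  fixes f :: "face \<Rightarrow> 'r::comm_ring_1"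
  assumes m: "m \<ge> 5" and f: "f \<in> morse_cocycles m 1"
    and faces: "\<And>\<sigma>. \<sigma> \<in> basis_faces m \<Longrightarrow> f \<sigma> = 0"
    and pairs: "\<And>a b. (a, b) \<in> basis_pairs m \<Longrightarrow> cell m f a b = 0"
  shows "f = 0"
proof -
  let ?n = "m - 1"
  have coch: "f \<in> morse_cochains m 1" using f unfolding morse_cocycle_iff by blast
  have rel: "cell m f a b + cell m f c d = cell m f a d + cell m f c b"
    if "1 \<le> a" "a < c" "c < m" "1 \<le> b" "b < d" "d < m" "a \<noteq> b" "a \<noteq> d" "c \<noteq> b" "c \<noteq> d" for a b c d
    using f that unfolding morse_cocycle_iff by blast
  have last_row: "cell m f ?n b = 0" if "1 \<le> b" "b < ?n" for b
  proof (cases "b = m - 2")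
    case True
    then show ?thesis using cochain_zero_rules(6)[OF coch] by simp
  next
    case False
    then have "b < m - 2" using that by linarith
    then show ?thesis using pairs[of ?n b] that m by (simp add: basis_pairs_iff)
  qed
  have last_col: "cell m f a ?n = 0" if "1 \<le> a" "a < ?n" for a
    using pairs[of a ?n] that m by (simp add: basis_pairs_iff)
  have row: "cell m f i b = cell m f i d"
    if "1 \<le> i" "i < ?n" "1 \<le> b" "b < ?n" "1 \<le> d" "d < ?n" "i \<noteq> b" "i \<noteq> d" for i b d
    using that
  proof (induction b d rule: linorder_wlog)
    case (le b d)
    then show ?case using rel[of i ?n b d] last_row[of b] last_row[of d] by (cases "b = d") auto
  qed simp
  have col: "cell m f a j = cell m f c j"
    if "1 \<le> j" "j < ?n" "1 \<le> a" "a < ?n" "1 \<le> c" "c < ?n" "j \<noteq> a" "j \<noteq> c" for j a c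
    using that
  proof (induction a c rule: linorder_wlog)
    case (le a c)
    then show ?case using rel[of a c j ?n] last_col[of a] last_col[of c] by (cases "a = c") auto
  qed simp
  have corner: "cell m f (m - 2) (m - 3) = 0"
    using pairs[of "m - 2" "m - 3"] m by (simp add: basis_pairs_iff)
  have via: "cell m f i (m - 3) = 0" if "1 \<le> i" "i < ?n" "i \<noteq> m - 3" for i
    using col[of "m - 3" i "m - 2"] corner that m by simp
  have inner: "cell m f i j = 0" if ij: "1 \<le> i" "i < ?n" "1 \<le> j" "j < ?n" "i \<noteq> j" for i j
  proof (cases "i = m - 3")
    case False
    then show ?thesis using row[of i j "m - 3"] via[of i] ij m by simp
  next
    case True
    \<comment> \<open>The second index cannot be \<open>m - 3\<close> when \<open>i = m - 3\<close>, hence the detour through \<open>i = 1\<close>.\<close>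
    have "cell m f i j = cell m f i (m - 2)" using row[of i j "m - 2"] ij True m by simp
    also have "\<dots> = cell m f 1 (m - 2)" using col[of "m - 2" i 1] ij True m by simp
    also have "\<dots> = cell m f 1 (m - 3)" using row[of 1 "m - 2" "m - 3"] m by simp
    also have "\<dots> = 0" using via[of 1] m by simp
    finally show ?thesis .
  qed
  show "f = 0"
  proof
    fix \<sigma> show "f \<sigma> = 0 \<sigma>"
    proof (cases "\<sigma> \<in> critical m 1")
      case crit: True
      then have "length \<sigma> = 2" by (simp add: critical_def faces_Suc_length)
      then obtain a b c d where \<sigma>: "\<sigma> = [(a, b), (c, d)]" by (rule length_2E)
      have range: "1 \<le> a" "1 \<le> b" "a \<noteq> b" "c \<noteq> d" "a \<le> c" "b \<le> d" "c \<le> m" "d \<le> m" "a < c \<or> b < d"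
        using crit unfolding \<sigma> critical_edge_iff edge_iff by blast+
      from crit[unfolded \<sigma> critical_edge_iff, THEN conjunct2] show ?thesis
      proof (elim disjE conjE, goal_cases)
        case 1
        have "a < ?n \<or> a = ?n" "b < ?n \<or> b = ?n" using 1 range(5) by linarith+
        then have "cell m f a b = 0"
          using range(1-3) inner[of a b] last_row[of b] last_col[of a] by blast
        then show ?case using 1 by (simp add: \<sigma> cell_def)
      next
        case 2
        then have "b < d" using range(9) by simp
        then have "\<sigma> \<in> basis_faces m" using 2 range(2) unfolding \<sigma> basis_faces_def by simp
        then show ?case using faces by simp
      next
        case 3
        then have "a < c" using range(9) by simp
        then have "\<sigma> \<in> basis_faces m" using 3 range(1) unfolding \<sigma> basis_faces_def by simp
        then show ?case using faces by simp
      qed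
    qed (use noncritical_zero[OF coch] in simp)
  qed
qed

section \<open>The elements \<open>\<langle>a, b\<rangle>\<close> of the family\<close>

text \<open>All elements \<open>\<langle>a, b\<rangle>\<close> of the family are differences of two such sums.\<close>

definition symb_sum :: "nat \<Rightarrow> (nat \<times> nat) set \<Rightarrow> face \<Rightarrow> 'r::comm_ring_1" where
  "symb_sum m A = (\<Sum>(i, j)\<in>A. symb m i j)"

lemma finite_symb_pairs: "finite (symb_pairs m)"
  by (rule finite_subset[where B = "{..m} \<times> {..m}"]) (auto simp: symb_pairs_def)

lemma symb_sum_apply:
  assumes "finite A"
  shows "symb_sum m A \<sigma> = of_bool (\<exists>p\<in>A. \<sigma> = [p, (m - 1, m)])"
proof -
  have "symb_sum m A \<sigma> = (\<Sum>p\<in>A. of_bool (\<sigma> = [p, (m - 1, m)]))"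
    unfolding symb_sum_def sum_fun_apply
    by (rule sum.cong[OF refl]) (simp add: symb_def dual_def split: prod.split)
  also have "\<dots> = of_bool (\<exists>p\<in>A. \<sigma> = [p, (m - 1, m)])"
  proof (cases "\<exists>p\<in>A. \<sigma> = [p, (m - 1, m)]")
    case True
    then obtain p where "p \<in> A" "\<sigma> = [p, (m - 1, m)]" by blast
    then show ?thesis using assms by (simp add: of_bool_def eq_commute[of p])
  next
    case False
    then have "\<sigma> \<noteq> [p, (m - 1, m)]" if "p \<in> A" for p using that by blast
    then have "(\<Sum>p\<in>A. of_bool (\<sigma> = [p, (m - 1, m)])) = (\<Sum>p\<in>A. 0 :: 'b)"
      by (intro sum.cong refl) simp
    with False show ?thesis by simp
  qed
  finally show ?thesis .
qed

lemma cell_symb_sum: "finite A \<Longrightarrow> cell m (symb_sum m A) i j = of_bool ((i, j) \<in> A)"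
  by (simp add: cell_def symb_sum_apply)

lemma symb_edge_critical:
  assumes "(i, j) \<in> symb_pairs m"
  shows "[(i, j), (m - 1, m)] \<in> critical m 1"
proof -
  have *: "1 \<le> i" "i < m" "1 \<le> j" "j < m" "j \<noteq> i" "\<not> (i = m - 1 \<and> j = m - 2)"
    using assms by (simp_all add: symb_pairs_def)
  moreover have "m - 1 \<noteq> m" "i \<le> m - 1" using * by linarith+
  ultimately show ?thesis unfolding critical_edge_iff edge_iff by simp
qed

lemma symb_sum_cochain:
  assumes "A \<subseteq> symb_pairs m"
  shows "symb_sum m A \<in> morse_cochains m 1"
proof -
  have "finite A" using assms finite_symb_pairs by (rule finite_subset)
  then show ?thesis
    using assms symb_edge_critical unfolding morse_cochains_def
    by (auto simp: symb_sum_apply simp del: One_nat_def)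
qed

lemma symb_row: "(\<Sum>j\<in>J. symb m i j) = symb_sum m ({i} \<times> J)"
  unfolding symb_sum_def sum.cartesian_product[symmetric] by simp

lemma symb_column: "(\<Sum>i\<in>I. symb m i j) = symb_sum m (I \<times> {j})"
  unfolding symb_sum_def sum.cartesian_product[symmetric] by simp

text \<open>Each \<open>\<langle>a, b\<rangle>\<close> of the family has cells of the form \<open>x i + y j\<close>, and its only nonzero coefficient at the
basis pairs is at \<open>(a, b)\<close>. With \<open>n = m - 1\<close> there are five kinds: the indicator of the cells with first
entry \<open>a\<close>, that of the cells with second entry \<open>b\<close>, the indicator of all cells with both entries below
\<open>n\<close>, and two corrections of the first two kinds, for \<open>(n - 1, n)\<close> and \<open>(n, n - 2)\<close>. There the plain
indicator would also be nonzero at \<open>(n - 1, n - 2)\<close>, so the third kind is subtracted from it.\<close>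

lemma angle_basis_pair:
  assumes m: "m \<ge> 5" and ab: "(a, b) \<in> basis_pairs m"
  obtains A B :: "(nat \<times> nat) set" and x y :: "nat \<Rightarrow> 'r::comm_ring_1" where
    "A \<subseteq> symb_pairs m" "B \<subseteq> symb_pairs m"
    "(angle m a b :: face \<Rightarrow> 'r) = symb_sum m A - symb_sum m B"
    "\<forall>i\<in>{1..<m}. \<forall>j\<in>{1..<m}. i \<noteq> j \<longrightarrow>
       of_bool ((i, j) \<in> A) - of_bool ((i, j) \<in> B) = x i + y j"
    "\<forall>i j. (i, j) \<in> basis_pairs m \<longrightarrow>
       of_bool ((i, j) \<in> A) - of_bool ((i, j) \<in> B) = (of_bool (i = a \<and> j = b) :: 'r)"
proof -
  define n where "n = m - 1"
  have n: "m = Suc n" "n \<ge> 4" using m by (simp_all add: n_def)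
  have shift: "m - 1 = n" "m - 2 = n - 1" "m - 3 = n - 2" using n by simp_all
  have empty: "symb_sum m {} = (0 :: face \<Rightarrow> 'r)" by (simp add: symb_sum_def)
  have pairs: "(i, j) \<in> basis_pairs m \<longleftrightarrow> j = n \<and> 1 \<le> i \<and> i < n \<or> i = n \<and> 1 \<le> j \<and> j < n - 1
      \<or> i = n - 1 \<and> j = n - 2" for i j
    unfolding basis_pairs_iff[OF m] using n by simp
  consider (row) "b = n" "1 \<le> a" "a < n - 1" | (corner_row) "b = n" "a = n - 1"
    | (column) "a = n" "1 \<le> b" "b < n - 2" | (corner_column) "a = n" "b = n - 2"
    | (block) "a = n - 1" "b = n - 2"
    using ab unfolding pairs by linarith
  then show ?thesis
  proof cases
    case row
    show ?thesis
    proof (rule that[of "{a} \<times> ({1..n} - {a})" "{}" "\<lambda>i. of_bool (i = a)" "\<lambda>_. 0"])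
      have "1 \<le> a \<and> a \<le> m - 3 \<and> b = m - 1" using row n by simp
      then show "(angle m a b :: face \<Rightarrow> 'r) = symb_sum m ({a} \<times> ({1..n} - {a})) - symb_sum m {}"
        unfolding angle_def using row by (simp add: symb_row empty)
    qed (use row n in \<open>auto simp: symb_pairs_def pairs[unfolded n(1)]\<close>)
  next
    case column
    show ?thesis
    proof (rule that[of "({1..n} - {b}) \<times> {b}" "{}" "\<lambda>_. 0" "\<lambda>j. of_bool (j = b)"])
      have "((1 \<le> a \<and> a \<le> 2) \<or> (1 \<le> a \<and> a \<le> m - 3 \<and> b = m - 1) \<or> (a, b) = (3, 1)) = False"
        "((4 \<le> a \<and> a \<le> m - 1 \<and> b = 1) \<or> (a = m - 1 \<and> 1 \<le> b \<and> b \<le> m - 4)) = True"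
        using column n by auto
      then show "(angle m a b :: face \<Rightarrow> 'r) = symb_sum m (({1..n} - {b}) \<times> {b}) - symb_sum m {}"
        unfolding angle_def using column by (simp only: if_True if_False symb_column empty diff_zero)
    qed (use column n in \<open>auto simp: symb_pairs_def pairs[unfolded n(1)]\<close>)
  next
    case corner_row
    \<comment> \<open>The functions \<open>x\<close> and \<open>y\<close> have to cancel at \<open>(i, n)\<close> with \<open>i < n - 1\<close>.\<close>
    show ?thesis
    proof (rule that[of "{(n - 1, n)}" "{(i, j). i \<in> {1..n - 2} \<and> j \<in> {1..n - 1} \<and> j \<noteq> i}"
          "\<lambda>i. - of_bool (i < n - 1)" "\<lambda>j. of_bool (j = n)"])
      have "((1 \<le> a \<and> a \<le> 2) \<or> (1 \<le> a \<and> a \<le> m - 3 \<and> b = m - 1) \<or> (a, b) = (3, 1)) = False"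
        "((4 \<le> a \<and> a \<le> m - 1 \<and> b = 1) \<or> (a = m - 1 \<and> 1 \<le> b \<and> b \<le> m - 4)) = False"
        "((a, b) = (3, 2)) = False" "(4 \<le> a \<and> a \<le> m - 2 \<and> b = 2) = False"
        "(a \<in> {3..m - 2} \<and> b \<in> {3..m - 2}) = False" "((a, b) = (m - 1, m - 3)) = False"
        "((a, b) = (m - 2, m - 1)) = True"
        using corner_row n by auto
      then have "(angle m a b :: face \<Rightarrow> 'r) = symb m (m - 2) (m - 1)
          - (\<Sum>(i, j) \<in> {(i, j). i \<in> {1..m - 3} \<and> j \<in> {1..m - 2} \<and> j \<noteq> i}. symb m i j)"
        unfolding angle_def by (simp only: if_True if_False)
      then show "(angle m a b :: face \<Rightarrow> 'r) = symb_sum m {(n - 1, n)}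
          - symb_sum m {(i, j). i \<in> {1..n - 2} \<and> j \<in> {1..n - 1} \<and> j \<noteq> i}"
        unfolding shift by (simp add: symb_sum_def)
    qed (use corner_row n in \<open>auto simp: symb_pairs_def pairs[unfolded n(1)]\<close>)
  next
    case corner_column
    show ?thesis
    proof (rule that[of "{(n, n - 2)}" "{(i, j). i \<in> {1..n - 1} \<and> j \<in> {1..n - 1} \<and> j \<noteq> n - 2 \<and> j \<noteq> i}"
          "\<lambda>i. - of_bool (i < n)" "\<lambda>j. of_bool (j = n \<or> j = n - 2)"])
      have "((1 \<le> a \<and> a \<le> 2) \<or> (1 \<le> a \<and> a \<le> m - 3 \<and> b = m - 1) \<or> (a, b) = (3, 1)) = False"
        "((4 \<le> a \<and> a \<le> m - 1 \<and> b = 1) \<or> (a = m - 1 \<and> 1 \<le> b \<and> b \<le> m - 4)) = False"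
        "((a, b) = (3, 2)) = False" "(4 \<le> a \<and> a \<le> m - 2 \<and> b = 2) = False"
        "(a \<in> {3..m - 2} \<and> b \<in> {3..m - 2}) = False" "((a, b) = (m - 1, m - 3)) = True"
        using corner_column n by auto
      then have "(angle m a b :: face \<Rightarrow> 'r) = symb m (m - 1) (m - 3)
          - (\<Sum>(i, j) \<in> {(i, j). i \<in> {1..m - 2} \<and> j \<in> {1..m - 2} \<and> j \<noteq> m - 3 \<and> j \<noteq> i}. symb m i j)"
        unfolding angle_def by (simp only: if_True if_False)
      then show "(angle m a b :: face \<Rightarrow> 'r) = symb_sum m {(n, n - 2)}
          - symb_sum m {(i, j). i \<in> {1..n - 1} \<and> j \<in> {1..n - 1} \<and> j \<noteq> n - 2 \<and> j \<noteq> i}"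
        unfolding shift by (simp add: symb_sum_def)
    qed (use corner_column n in \<open>auto simp: symb_pairs_def pairs[unfolded n(1)]\<close>)
  next
    case block
    let ?A = "{(i, j). i \<in> {1..n - 1} \<and> j \<in> {1..n - 1} \<and> i \<noteq> j}"
    \<comment> \<open>For \<open>m = 5\<close> this is the element \<open>\<langle>3, 2\<rangle>\<close>, which has a definition of its own.\<close>
    show ?thesis
    proof (rule that[of ?A "{}" "\<lambda>i. of_bool (i < n)" "\<lambda>j. - of_bool (j = n)"])
      show "(angle m a b :: face \<Rightarrow> 'r) = symb_sum m ?A - symb_sum m {}"
      proof (cases "n = 4")
        case True
        have "?A = {(3, 2), (3, 1), (2, 3), (2, 1), (1, 3), (1, 2)}"
          unfolding True by auto
        moreover have "angle m a b = (symb m 3 2 + symb m 3 1 + symb m 2 3 + symb m 2 1 + symb m 1 3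
            + symb m 1 2 :: face \<Rightarrow> 'r)"
          using block True n unfolding angle_def by simp
        ultimately show ?thesis unfolding empty by (simp add: symb_sum_def add.assoc)
      next
        case False
        let ?A1 = "{(i, j). i \<in> {1..a} \<and> j \<in> {1..b} \<and> j \<noteq> i \<and> j \<noteq> a}"
        have "((1 \<le> a \<and> a \<le> 2) \<or> (1 \<le> a \<and> a \<le> m - 3 \<and> b = m - 1) \<or> (a, b) = (3, 1)) = False"
          "((4 \<le> a \<and> a \<le> m - 1 \<and> b = 1) \<or> (a = m - 1 \<and> 1 \<le> b \<and> b \<le> m - 4)) = False"
          "((a, b) = (3, 2)) = False" "(4 \<le> a \<and> a \<le> m - 2 \<and> b = 2) = False"
          "(a \<in> {3..m - 2} \<and> b \<in> {3..m - 2}) = True"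
          using block n False by auto
        then have "(angle m a b :: face \<Rightarrow> 'r) = symb_sum m ?A1 + symb_sum m ({1..a - 1} \<times> {a})"
          unfolding angle_def by (simp only: if_True if_False symb_column symb_sum_def)
        also have "\<dots> = symb_sum m (?A1 \<union> {1..a - 1} \<times> {a})"
          unfolding symb_sum_def
        proof (rule sum.union_disjoint[symmetric])
          show "finite ?A1" by (rule finite_subset[of _ "{1..a} \<times> {1..b}"]) auto
        qed auto
        also have "?A1 \<union> {1..a - 1} \<times> {a} = ?A" using block n by auto
        finally show ?thesis unfolding empty by simp
      qed
    qed (use block n in \<open>auto simp: symb_pairs_def pairs[unfolded n(1)]\<close>)
  qed
qed

section \<open>The basis\<close>

lemma basis_face_critical:
  assumes "\<sigma> \<in> basis_faces m"
  shows "\<sigma> \<in> critical m 1" and "\<sigma> \<noteq> [p, (m - 1, m)]"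
proof -
  from assms consider b d where "\<sigma> = [(m, b), (m, d)]" "1 \<le> b" "b < d" "d < m - 1"
    | a c where "\<sigma> = [(a, m), (c, m)]" "1 \<le> a" "a < c" "c < m - 1"
    unfolding basis_faces_def by blast
  then have "\<sigma> \<in> critical m 1 \<and> \<sigma> \<noteq> [p, (m - 1, m)]"
  proof cases
    case 1
    then have "m \<noteq> b" "m \<noteq> d" "1 \<le> m" "d \<le> m" "m \<noteq> m - 1" by linarith+
    with 1 show ?thesis unfolding 1(1) critical_edge_iff edge_iff by simp
  next
    case 2
    then have "a \<noteq> m" "c \<noteq> m" "1 \<le> m" "c \<le> m" "c \<noteq> m - 1" by linarith+
    with 2 show ?thesis unfolding 2(1) critical_edge_iff edge_iff by simp
  qed
  then show "\<sigma> \<in> critical m 1" "\<sigma> \<noteq> [p, (m - 1, m)]" by blast+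
qed

lemma dual_basis_face_cocycle:
  assumes "\<sigma> \<in> basis_faces m"
  shows "dual \<sigma> \<in> morse_cocycles m 1"
proof (rule cocycle_if_additive)
  show "dual \<sigma> \<in> morse_cochains m 1"
    using basis_face_critical(1)[OF assms] by (auto simp: morse_cochains_def dual_def)
  show "cell m (dual \<sigma>) i j = 0 + 0" for i j
    using basis_face_critical(2)[OF assms, of "(i, j)"] by (auto simp: cell_def dual_def)
qed

lemma
  assumes m: "m \<ge> 5" and ab: "(a, b) \<in> basis_pairs m"
  shows angle_cocycle: "(angle m a b :: face \<Rightarrow> 'r::comm_ring_1) \<in> morse_cocycles m 1"
    and angle_basis_face: "\<sigma> \<in> basis_faces m \<Longrightarrow> (angle m a b \<sigma> :: 'r) = 0"
    and angle_basis_cell: "(i, j) \<in> basis_pairs m \<Longrightarrow>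
      cell m (angle m a b) i j = (of_bool (i = a \<and> j = b) :: 'r)"
proof -
  obtain A B and x y :: "nat \<Rightarrow> 'r" where AB: "A \<subseteq> symb_pairs m" "B \<subseteq> symb_pairs m"
    and angle: "(angle m a b :: face \<Rightarrow> 'r) = symb_sum m A - symb_sum m B"
    and additive: "\<forall>i\<in>{1..<m}. \<forall>j\<in>{1..<m}. i \<noteq> j \<longrightarrow>
       of_bool ((i, j) \<in> A) - of_bool ((i, j) \<in> B) = x i + y j"
    and delta: "\<forall>i j. (i, j) \<in> basis_pairs m \<longrightarrow>
       of_bool ((i, j) \<in> A) - of_bool ((i, j) \<in> B) = (of_bool (i = a \<and> j = b) :: 'r)"
    by (rule angle_basis_pair[OF m ab, where 'r = 'r]) (rule that)
  have fin: "finite A" "finite B"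
    using AB finite_symb_pairs by (auto intro: finite_subset)
  have cells: "cell m (angle m a b) i j = (of_bool ((i, j) \<in> A) - of_bool ((i, j) \<in> B) :: 'r)" for i j
    unfolding angle cell_diff by (simp add: cell_symb_sum fin)
  show "(angle m a b :: face \<Rightarrow> 'r) \<in> morse_cocycles m 1"
  proof (rule cocycle_if_additive)
    show "(angle m a b :: face \<Rightarrow> 'r) \<in> morse_cochains m 1"
      unfolding angle
      by (intro fun_module.subspace_diff[OF morse_cochains_subspace] symb_sum_cochain AB)
    show "cell m (angle m a b) i j = x i + y j"
      if "1 \<le> i" "i < m" "1 \<le> j" "j < m" "i \<noteq> j" for i j
      unfolding cells by (rule additive[rule_format]) (use that in simp_all)
  qed
  show "(angle m a b \<sigma> :: 'r) = 0" if "\<sigma> \<in> basis_faces m"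
    unfolding angle using basis_face_critical(2)[OF that] by (simp add: symb_sum_apply fin)
  show "cell m (angle m a b) i j = (of_bool (i = a \<and> j = b) :: 'r)" if "(i, j) \<in> basis_pairs m"
    unfolding cells by (rule delta[rule_format, OF that])
qed

theorem corollary4p7:
  fixes m :: nat
  assumes "m \<ge> 5"
  shows "basis_family
           (basis_faces m <+> basis_pairs m)
           (case_sum dual (\<lambda>(a, b). angle m a b))
           (morse_cocycles m 1 :: (face \<Rightarrow> 'r::comm_ring_1) set)"
\<comment> \<open>A basis face is its own evaluation point; a basis pair \<open>p\<close> is evaluated at the face of its symbol.\<close>
proof (rule basis_family_dual_points[where e = "case_sum id (\<lambda>p. [p, (m - 1, m)])"])
  have "finite (basis_faces m)"
    by (rule finite_subset[OF _ finite_critical[of m 1]]) (use basis_face_critical(1) in blast)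
  moreover have "finite (basis_pairs m)"
    by (rule finite_subset[OF _ finite_symb_pairs[of m]]) (auto simp: basis_pairs_def)
  ultimately show "finite (basis_faces m <+> basis_pairs m)" by simp
next
  show "fun_module.subspace (morse_cocycles m 1 :: (face \<Rightarrow> 'r) set)"
    by (rule morse_cocycles_subspace)
next
  fix i assume "i \<in> basis_faces m <+> basis_pairs m"
  then show "case_sum dual (\<lambda>(a, b). angle m a b) i \<in> (morse_cocycles m 1 :: (face \<Rightarrow> 'r) set)"
  proof (elim PlusE)
    fix \<sigma> assume "\<sigma> \<in> basis_faces m" "i = Inl \<sigma>"
    then show ?thesis by (simp add: dual_basis_face_cocycle del: One_nat_def)
  next
    fix p assume "p \<in> basis_pairs m" "i = Inr p"
    then show ?thesis by (cases p) (simp add: angle_cocycle[OF assms] del: One_nat_def)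
  qed
next
  fix i j assume "i \<in> basis_faces m <+> basis_pairs m" "j \<in> basis_faces m <+> basis_pairs m"
  then show "case_sum dual (\<lambda>(a, b). angle m a b) i (case_sum id (\<lambda>p. [p, (m - 1, m)]) j)
      = (if i = j then 1 else 0 :: 'r)"
  proof (elim PlusE)
    fix \<sigma> \<tau> assume "i = Inl \<sigma>" "j = Inl \<tau>"
    then show ?thesis by (simp add: dual_def)
  next
    fix \<sigma> p assume "\<sigma> \<in> basis_faces m" "i = Inl \<sigma>" "j = Inr p"
    then show ?thesis using basis_face_critical(2)[of \<sigma> m p] by (auto simp: dual_def)
  next
    fix p \<tau> assume "p \<in> basis_pairs m" "\<tau> \<in> basis_faces m" "i = Inr p" "j = Inl \<tau>"
    then show ?thesis by (cases p) (simp add: angle_basis_face[OF assms])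
  next
    fix p q assume "p \<in> basis_pairs m" "q \<in> basis_pairs m" "i = Inr p" "j = Inr q"
    then show ?thesis
      using angle_basis_cell[OF assms, of "fst p" "snd p" "fst q" "snd q", where 'r = 'r]
      by (cases p; cases q) (auto simp: cell_def of_bool_def)
  qed
next
  fix f :: "face \<Rightarrow> 'r"
  assume f: "f \<in> morse_cocycles m 1"
    and zero: "\<And>i. i \<in> basis_faces m <+> basis_pairs m \<Longrightarrow> f (case_sum id (\<lambda>p. [p, (m - 1, m)]) i) = 0"
  show "f = 0"
  proof (rule cocycle_zero_if_zero_on_basis_points[OF assms f])
    show "f \<sigma> = 0" if "\<sigma> \<in> basis_faces m" for \<sigma> using zero[OF InlI[OF that]] by simp
    show "cell m f a b = 0" if "(a, b) \<in> basis_pairs m" for a b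
      using zero[OF InrI[OF that]] by (simp add: cell_def)
  qed
qed

end
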